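(* Let $E_1,E_0,E_{-1}$ be separable Hilbert spaces with $E_1$ compactly and densely embedded in $E_0$ and $E_0$ continuously and densely embedded in $E_{-1}$. Suppose there exist $\theta\in(0,1)$ and $M>0$ such that $\|v\|_{E_0}\le M\|v\|_{E_1}^{1-\theta}\|v\|_{E_{-1}}^{\theta}$ for all $v\in E_1$. Let $\{e_n\}_{n\ge1}\subset E_1$ have span dense in $E_{-1}$, let $E^n=\mathrm{span}\{e_1,\dots,e_n\}$, let $\Pi_n$ be the orthogonal projector from $E_{-1}$ onto $E^n$, and suppose there is $C>0$ with $\|\Pi_n x\|_{E_1}\le C\|x\|_{E_1}$ for all $x\in E_1$ and all $n\ge1$. Let $b,\sigma:E_0\to E_{-1}$ be Borel functions, and set $b_n(x)=\Pi_n b(x)$, $\sigma_n(x)=\Pi_n\sigma(x)$ for $x\in E^n$. Assume the following on the drift and the initial condition: (b-a) $b:E_0\to E_{-1}$ is continuous and bounded on balls. (b-b) There exist $R\ge1$ and a non-negative Borel function $g:E_1\to\mathbb{R}$, bounded on balls, such that $\langle b_n(x),x\rangle_{E_1}\le g(x)\|x\|_{E_1}^2$ for every $n$ and every $x\in E^n$ with $\|x\|_{E_1}\ge R$. (b-c) $b_n:E^n\to E^n$ is locally Lipschitz for every $n$. (b-d) The initial condition $X_0$ is an $E_1$-valued random variable independent of the driving Brownian motion. (b-e) There is an increasing function $k:\mathbb{R}\to\mathbb{R}_+$ such that $\langle b(x)-b(y),x-y\rangle_{E_{-1}}\le k(\|x\|_{E_0}\vee\|y\|_{E_0})\|x-y\|_{E_{-1}}^2$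 for all $x,y\in E_0$. Assume the following on the diffusion coefficient: ($\sigma$-a) $\sigma:E_0\to E_{-1}$ is continuous and bounded on balls. ($\sigma$-b) There exist a Borel function $f:E_1\to\mathbb{R}$, bounded on balls, and constants $G,L>0$ such that $\sigma(x)=f(x)x$ for every $x\in E_1$ with $\|x\|_{E_1}\ge R$ and $g(x)>G$, and $\|\sigma(x)\|_{E_1}\le L\|x\|_{E_1}$ for every $x\in E_1$ with $\|x\|_{E_1}\ge R$ and $g(x)\le G$. ($\sigma$-c) There is a constant $K\ge0$ such that $|f(x)|^2\ge 2g(x)-K$ for every $x\in E_1$ with $\|x\|_{E_1}\ge R$ and $g(x)>G$. ($\sigma$-d) $\sigma_n:E^n\to E^n$ is locally Lipschitz for every $n$. ($\sigma$-e) There is an increasing function $h:\mathbb{R}\to\mathbb{R}_+$ such that $\|\sigma(x)-\sigma(y)\|_{E_{-1}}\le h(\|x\|_{E_0}\vee\|y\|_{E_0})\|x-y\|_{E_{-1}}$ for all $x,y\in E_0$. Then pathwise uniqueness holds for $dX_t=b(X_t)\,dt+\sigma(X_t)\,dW_t$: if $X^{(1)}$ and $X^{(2)}$ are two solutions on the same filtered probability space $(\Omega,\mathcal A,(\mathcal F_t)_t,\mathbb P)$, with respect to the same Brownian motion $W$ and with the same initial condition $X_0$, then, for every $T>0$, $$\mathbb{P}\big\{X^{(1)}_t=X^{(2)}_t,\ \forall t\in[0,T]\big\}=1.$$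
   Context: A function $F:\mathcal H\to\mathcal K$ between Hilbert spaces (or into $\mathbb R$) is bounded on balls if $\sup_{\|x\|_{\mathcal H}\le r}\|F(x)\|_{\mathcal K}<\infty$ for every $r>0$. The notation $a\vee b$ means $\max\{a,b\}$. In ($\sigma$-b) the bound $\|\sigma(x)\|_{E_1}\le L\|x\|_{E_1}$ includes the requirement $\sigma(x)\in E_1$. A solution on a filtered probability space $(\Omega,\mathcal A,(\mathcal F_t)_t,\mathbb P)$ satisfying the usual conditions (complete, right-continuous filtration), with respect to a one-dimensional $(\mathcal F_t)$-Brownian motion $W$, is a process $X$ such that: (i) $X$ is $(\mathcal F_t)$-progressively measurable with values in $E_0$ and has $\mathbb P$-a.s. continuous paths in $E_0$; (ii) $\mathbb P$-a.s., $t\mapsto b(X_t)$ is locally integrable and $t\mapsto\sigma(X_t)$ is locally square-integrable on $[0,\infty)$ with values in $E_{-1}$; (iii) $\mathbb P$-a.s., $X_t=X_0+\int_0^t b(X_r)\,dr+\int_0^t\sigma(X_r)\,dW_r$ in $E_{-1}$ for all $t\ge0$. *)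

theory Defs
  imports "HOL-Probability.Probability"
begin

section \<open>Embeddings and Galerkin projections\<close>

(* A Hilbert space is a type of sort {real_inner, banach}; it is separable when it is also
   second countable.  An embedding of one Hilbert space into another is given by an injective
   bounded linear map, so "x \<in> E1" is read inside E0 or E-1 through this map. *)

definition dense_embedding :: "('a::real_normed_vector \<Rightarrow> 'b::real_normed_vector) \<Rightarrow> bool" where
  "dense_embedding j \<longleftrightarrow> bounded_linear j \<and> inj j \<and> closure (range j) = UNIV"

definition compact_dense_embedding :: "('a::real_normed_vector \<Rightarrow> 'b::real_normed_vector) \<Rightarrow> bool" where
  "compact_dense_embedding j \<longleftrightarrow>
     dense_embedding j \<and> (\<forall>B. bounded B \<longrightarrow> compact (closure (j ` B)))"

definition galerkin_space :: "(nat \<Rightarrow> 'a::real_vector) \<Rightarrow> nat \<Rightarrow> 'a set" where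
  "galerkin_space e n = span (e ` {1..n})"

definition orth_proj :: "'a::real_inner set \<Rightarrow> 'a \<Rightarrow> 'a" where
  "orth_proj S y = (THE p. p \<in> S \<and> (\<forall>v\<in>S. orthogonal (y - p) v))"

(* The orthogonal projector in E-1 (the codomain of the embedding j of E1) onto the image of
   E^n = span {e 1, ..., e n}; its value is returned as an element of E^n in E1. *)
definition galerkin_proj ::
    "('a::real_vector \<Rightarrow> 'b::real_inner) \<Rightarrow> (nat \<Rightarrow> 'a) \<Rightarrow> nat \<Rightarrow> 'b \<Rightarrow> 'a" where
  "galerkin_proj j e n y = inv j (orth_proj (j ` galerkin_space e n) y)"

definition bounded_on_balls :: "('a::real_normed_vector \<Rightarrow> 'b::real_normed_vector) \<Rightarrow> bool" where
  "bounded_on_balls F \<longleftrightarrow> (\<forall>r>0. bounded (F ` cball 0 r))"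

definition locally_lipschitz_on ::
    "'a::metric_space set \<Rightarrow> ('a \<Rightarrow> 'b::metric_space) \<Rightarrow> bool" where
  "locally_lipschitz_on S F \<longleftrightarrow>
     (\<forall>x\<in>S. \<exists>\<epsilon>>0. \<exists>L. L-lipschitz_on (cball x \<epsilon> \<inter> S) F)"


section \<open>Filtrations and processes\<close>

(* Time is [0,\<infinity>).  Filtrations and processes are indexed by real, but nothing is required of
   them at negative times. *)

definition usual_filtered_prob_space :: "'w measure \<Rightarrow> (real \<Rightarrow> 'w measure) \<Rightarrow> bool" where
  "usual_filtered_prob_space P F \<longleftrightarrow>
     prob_space P \<and> complete_measure P \<and>
     (\<forall>t\<ge>0. subalgebra P (F t)) \<and>
     (\<forall>s t. 0 \<le> s \<longrightarrow> s \<le> t \<longrightarrow> sets (F s) \<subseteq> sets (F t)) \<and>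
     null_sets P \<subseteq> sets (F 0) \<and>
     (\<forall>t\<ge>0. (\<Inter>u\<in>{t<..}. sets (F u)) = sets (F t))"

definition adapted_process ::
    "(real \<Rightarrow> 'w measure) \<Rightarrow> (real \<Rightarrow> 'w \<Rightarrow> 'e::topological_space) \<Rightarrow> bool" where
  "adapted_process F X \<longleftrightarrow> (\<forall>t\<ge>0. X t \<in> borel_measurable (F t))"

definition progressive_process ::
    "(real \<Rightarrow> 'w measure) \<Rightarrow> (real \<Rightarrow> 'w \<Rightarrow> 'e::topological_space) \<Rightarrow> bool" where
  "progressive_process F X \<longleftrightarrow>
     (\<forall>t\<ge>0. (\<lambda>(s, \<omega>). X s \<omega>) \<in> borel_measurable (restrict_space borel {0..t} \<Otimes>\<^sub>M F t))"

definition ae_continuous_paths ::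
    "'w measure \<Rightarrow> (real \<Rightarrow> 'w \<Rightarrow> 'e::topological_space) \<Rightarrow> bool" where
  "ae_continuous_paths P X \<longleftrightarrow> (AE \<omega> in P. continuous_on {0..} (\<lambda>t. X t \<omega>))"

definition brownian_motion ::
    "'w measure \<Rightarrow> (real \<Rightarrow> 'w measure) \<Rightarrow> (real \<Rightarrow> 'w \<Rightarrow> real) \<Rightarrow> bool" where
  "brownian_motion P F W \<longleftrightarrow>
     adapted_process F W \<and> ae_continuous_paths P W \<and>
     (AE \<omega> in P. W 0 \<omega> = 0) \<and>
     (\<forall>s t. 0 \<le> s \<longrightarrow> s < t \<longrightarrow>
        distributed P lborel (\<lambda>\<omega>. W t \<omega> - W s \<omega>) (normal_density 0 (sqrt (t - s))) \<and>
        prob_space.indep_set P (sets (F s))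
          (sets (vimage_algebra (space P) (\<lambda>\<omega>. W t \<omega> - W s \<omega>) borel)))"

definition process_events :: "'w measure \<Rightarrow> (real \<Rightarrow> 'w \<Rightarrow> 'e::topological_space) \<Rightarrow> 'w set set" where
  "process_events P X =
     sigma_sets (space P) {X t -` A \<inter> space P | t A. 0 \<le> t \<and> A \<in> sets borel}"

definition indep_of_process ::
    "'w measure \<Rightarrow> ('w \<Rightarrow> 'a::topological_space) \<Rightarrow> (real \<Rightarrow> 'w \<Rightarrow> 'e::topological_space) \<Rightarrow> bool" where
  "indep_of_process P Y X \<longleftrightarrow>
     prob_space.indep_set P (sets (vimage_algebra (space P) Y borel)) (process_events P X)"


section \<open>The Ito integral\<close>

(* The elementary integrand  sum_{i<m} xi i * 1_{(\<tau> i, \<tau> (i+1)]}  with xi i bounded and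
   F (\<tau> i)-measurable, given by the data m, \<tau>, xi. *)
definition elementary_data ::
    "'w measure \<Rightarrow> (real \<Rightarrow> 'w measure) \<Rightarrow> nat \<Rightarrow> (nat \<Rightarrow> real) \<Rightarrow>
     (nat \<Rightarrow> 'w \<Rightarrow> 'e::real_normed_vector) \<Rightarrow> bool" where
  "elementary_data P F m \<tau> \<xi> \<longleftrightarrow>
     0 \<le> \<tau> 0 \<and> (\<forall>i<m. \<tau> i \<le> \<tau> (Suc i)) \<and>
     (\<forall>i<m. \<xi> i \<in> borel_measurable (F (\<tau> i)) \<and> bounded (\<xi> i ` space P))"

definition elementary_process ::
    "nat \<Rightarrow> (nat \<Rightarrow> real) \<Rightarrow> (nat \<Rightarrow> 'w \<Rightarrow> 'e::real_normed_vector) \<Rightarrow> real \<Rightarrow> 'w \<Rightarrow> 'e" where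
  "elementary_process m \<tau> \<xi> t \<omega> =
     (\<Sum>i<m. indicat_real {\<tau> i<..\<tau> (Suc i)} t *\<^sub>R \<xi> i \<omega>)"

definition elementary_integral ::
    "(real \<Rightarrow> 'w \<Rightarrow> real) \<Rightarrow> nat \<Rightarrow> (nat \<Rightarrow> real) \<Rightarrow>
     (nat \<Rightarrow> 'w \<Rightarrow> 'e::real_normed_vector) \<Rightarrow> real \<Rightarrow> 'w \<Rightarrow> 'e" where
  "elementary_integral W m \<tau> \<xi> t \<omega> =
     (\<Sum>i<m. (W (min t (\<tau> (Suc i))) \<omega> - W (min t (\<tau> i)) \<omega>) *\<^sub>R \<xi> i \<omega>)"

(* Measurability is part of the definition because measure assigns 0 to non-measurable sets. *)
definition tendsto_zero_in_prob :: "'w measure \<Rightarrow> (nat \<Rightarrow> 'w \<Rightarrow> ennreal) \<Rightarrow> bool" where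
  "tendsto_zero_in_prob P Z \<longleftrightarrow>
     (\<forall>k. Z k \<in> borel_measurable P) \<and>
     (\<forall>\<epsilon>>0. (\<lambda>k. measure P {\<omega>\<in>space P. ennreal \<epsilon> < Z k \<omega>}) \<longlonglongrightarrow> 0)"

(* I is (a version of) the process t \<mapsto> \<integral>_0^t H_r dW_r for a progressive integrand H whose paths
   are a.s. locally square-integrable: H is approximated by elementary integrands, in probability
   for the L2([0,T]) norm of the paths, and I is the limit of the elementary integrals, uniformly
   on [0,T] in probability, for every T.  By the Ito isometry and localization, such I exists, does
   not depend on the approximating sequence, and is unique up to indistinguishability.  The a.s.
   local square-integrability of H is implied by the approximation, since elementary integrands
   are bounded with bounded support.  All measurability hidden in tendsto_zero_in_prob is automatic
   on a complete filtered space, because elementary integrals and I are a.s. continuous. *)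
definition has_ito_integral ::
    "'w measure \<Rightarrow> (real \<Rightarrow> 'w measure) \<Rightarrow> (real \<Rightarrow> 'w \<Rightarrow> real) \<Rightarrow>
     (real \<Rightarrow> 'w \<Rightarrow> 'e::real_normed_vector) \<Rightarrow> (real \<Rightarrow> 'w \<Rightarrow> 'e) \<Rightarrow> bool" where
  "has_ito_integral P F W H I \<longleftrightarrow>
     progressive_process F H \<and> adapted_process F I \<and> ae_continuous_paths P I \<and>
     (\<exists>m \<tau> \<xi>.
        (\<forall>k. elementary_data P F (m k) (\<tau> k) (\<xi> k)) \<and>
        (\<forall>T>0.
           tendsto_zero_in_prob P
             (\<lambda>k \<omega>. \<integral>\<^sup>+r\<in>{0..T}.
                ennreal ((norm (elementary_process (m k) (\<tau> k) (\<xi> k) r \<omega> - H r \<omega>))\<^sup>2) \<partial>lborel) \<and>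
           tendsto_zero_in_prob P
             (\<lambda>k \<omega>. SUP t\<in>{0..T}.
                ennreal (norm (elementary_integral W (m k) (\<tau> k) (\<xi> k) t \<omega> - I t \<omega>)))))"


section \<open>Solutions\<close>

(* j embeds E0 (where X lives) into E-1 (where the equation holds). *)
definition sde_solution ::
    "('a::{real_normed_vector, second_countable_topology} \<Rightarrow>
        'b::{banach, second_countable_topology}) \<Rightarrow>
     ('a \<Rightarrow> 'b) \<Rightarrow> ('a \<Rightarrow> 'b) \<Rightarrow> 'w measure \<Rightarrow> (real \<Rightarrow> 'w measure) \<Rightarrow>
     (real \<Rightarrow> 'w \<Rightarrow> real) \<Rightarrow> (real \<Rightarrow> 'w \<Rightarrow> 'a) \<Rightarrow> bool" where
  "sde_solution j b \<sigma> P F W X \<longleftrightarrow>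
     progressive_process F X \<and> ae_continuous_paths P X \<and>
     (AE \<omega> in P. \<forall>T>0.
        set_integrable lborel {0..T} (\<lambda>r. b (X r \<omega>)) \<and>
        set_borel_measurable lborel {0..T} (\<lambda>r. \<sigma> (X r \<omega>)) \<and>
        set_integrable lborel {0..T} (\<lambda>r. (norm (\<sigma> (X r \<omega>)))\<^sup>2)) \<and>
     (\<exists>I. has_ito_integral P F W (\<lambda>r \<omega>. \<sigma> (X r \<omega>)) I \<and>
        (AE \<omega> in P. \<forall>t\<ge>0.
           j (X t \<omega>) = j (X 0 \<omega>) + (LINT r:{0..t}|lborel. b (X r \<omega>)) + I t \<omega>))"

end

theory Submission
  imports Defs
begin

text \<open>
  Let Y be the difference of the two solutions in E-1. The one-sided Lipschitz condition and the
  Lipschitz condition give d|Y|^2 <= c |Y|^2 dt + martingale as long as both solutions stay in a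
  ball of radius N of E0, so Gronwall forces Y = 0 there, and N tends to infinity. Instead of an Ito
  formula, the energy estimate is carried out in discrete time: the stochastic integrals are
  replaced by elementary ones, all of whose jump times lie on a fine grid, and the discrete scheme
  is frozen at the first grid cell in which a solution leaves the ball, Y oscillates too much, or the
  elementary approximation is bad. The event that this happens although the solutions stay in the
  ball has small probability.
\<close>

section \<open>Grids and Gronwall's inequality\<close>

text \<open>The Ito integral is given only as a limit in probability of elementary integrals, whose
  integrands need not be bounded uniformly along the sequence, so moments do not pass to the limit.
  The second-moment estimate is therefore proved for an auxiliary scheme \<open>Z\<close>, with
  constants free of the elementary data, and \<open>Z\<close> is compared with Y only on suitable
  paths. This fixes the order of choices: the accuracy \<epsilon>, then a modulus of continuity,
  then the elementary integrands, and only then the mesh, which may depend on their bound.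

  The other obstacle is the information available in time. An increment of W is independent of the
  past at the left end of its cell, so whether the scheme runs on a cell is decided there; whether
  the solutions behave well throughout the cell is known only at the right end. One bad cell may
  thus be let through, and a fine mesh has to pay for it. The drift increment is also known only at
  the right end and may be correlated with the increment of W.\<close>

lemma discrete_gronwall:
  fixes a \<delta> :: "nat \<Rightarrow> real"
  assumes step: "\<And>l. l \<le> n \<Longrightarrow> a l \<le> \<kappa> + c * (\<Sum>i<l. \<delta> i * a i)"
    and pos: "\<And>i. i < n \<Longrightarrow> 0 \<le> \<delta> i" and c: "0 \<le> c" and \<kappa>: "0 \<le> \<kappa>"
  shows "a n \<le> \<kappa> * exp (c * (\<Sum>i<n. \<delta> i))"
proof -
  \<comment> \<open>The induction bounds the right-hand side of \<open>step\<close>, not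
    \<open>a\<close> itself: adding an index multiplies it by at most 1 + c * \<delta> l \<le> exp
    (c * \<delta> l).\<close>
  have "\<kappa> + c * (\<Sum>i<l. \<delta> i * a i) \<le> \<kappa> * exp (c * (\<Sum>i<l. \<delta> i))" if "l \<le> n" for l
    using that
  proof (induction l)
    case 0
    then show ?case by simp
  next
    case (Suc l)
    let ?s = "\<kappa> + c * (\<Sum>i<l. \<delta> i * a i)" and ?e = "\<kappa> * exp (c * (\<Sum>i<l. \<delta> i))"
    have d: "0 \<le> c * \<delta> l" using pos[of l] c Suc.prems by simp
    have "\<kappa> + c * (\<Sum>i<Suc l. \<delta> i * a i) = ?s + c * \<delta> l * a l"
      by (simp add: algebra_simps)
    also have "\<dots> \<le> ?s + c * \<delta> l * ?s"
      using step[of l] Suc.prems d by (intro add_left_mono mult_left_mono) auto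
    also have "\<dots> = ?s * (1 + c * \<delta> l)" by (simp add: algebra_simps)
    also have "\<dots> \<le> ?e * (1 + c * \<delta> l)"
      using Suc d by (intro mult_right_mono) auto
    also have "\<dots> \<le> ?e * exp (c * \<delta> l)"
      using \<kappa> by (intro mult_left_mono exp_ge_add_one_self) auto
    also have "\<dots> = \<kappa> * exp (c * (\<Sum>i<Suc l. \<delta> i))"
      by (simp add: exp_add algebra_simps)
    finally show ?case .
  qed
  with step[of n] show ?thesis by force
qed

lemma sorted_distinct_consecutive:
  fixes xs :: "'a::linorder list"
  assumes "sorted xs" "distinct xs" "Suc l < length xs" "x \<in> set xs"
  shows "\<not> (xs ! l < x \<and> x < xs ! Suc l)"
proof
  assume *: "xs ! l < x \<and> x < xs ! Suc l"
  obtain p where p: "p < length xs" "x = xs ! p"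
    using assms(4) by (auto simp: in_set_conv_nth)
  have "p \<le> l \<or> Suc l \<le> p" by linarith
  then show False
    using * p assms(1,3) sorted_nth_mono[of xs p l] sorted_nth_mono[of xs "Suc l" p] by fastforce
qed

text \<open>\<open>Q\<close> is meant for the jump times of the elementary integrands: with none of
  them inside a cell, the integrands are constant there. Only interior points are excluded because
  these cells are open on the left and closed on the right. The grid consists of the endpoints, of
  \<open>Q\<close> and of the multiples of \<delta>, sorted.\<close>

lemma grid_exists:
  fixes Q :: "real set"
  assumes Q: "finite Q" and T: "0 < T" and \<delta>: "0 < \<delta>"
  obtains u :: "nat \<Rightarrow> real" and n :: nat
  where "u 0 = 0" "u n = T"
    "\<And>l. l < n \<Longrightarrow> u l < u (Suc l)"
    "\<And>l. l < n \<Longrightarrow> u (Suc l) - u l \<le> \<delta>"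
    "\<And>l q. l < n \<Longrightarrow> q \<in> Q \<Longrightarrow> \<not> (u l < q \<and> q < u (Suc l))"
proof -
  define A where "A = {0, T} \<union> (Q \<inter> {0..T}) \<union> ((\<lambda>i::nat. real i * \<delta>) ` {..nat \<lceil>T / \<delta>\<rceil>} \<inter> {0..T})"
  define xs where "xs = sorted_list_of_set A"
  define n where "n = length xs - 1"
  have fin: "finite A" using Q by (auto simp: A_def)
  have sub: "A \<subseteq> {0..T}" using T by (auto simp: A_def)
  have xs: "sorted xs" "distinct xs" "set xs = A"
    using fin by (auto simp: xs_def)
  have "xs \<noteq> []" using xs(3) by (auto simp: A_def)
  then have ne: "0 < length xs" by simp
  have len: "length xs = Suc n" using ne by (simp add: n_def)
  have first: "xs ! 0 = 0"
  proof -
    have "0 \<in> set xs" using xs(3) by (simp add: A_def)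
    then obtain p where "p < length xs" "xs ! p = 0"
      unfolding in_set_conv_nth by blast
    then have "xs ! 0 \<le> 0" using sorted_nth_mono[OF xs(1), of 0 p] by simp
    moreover have "xs ! 0 \<in> A" using nth_mem[OF ne] xs(3) by auto
    ultimately show ?thesis using sub by force
  qed
  have last: "xs ! n = T"
  proof -
    have "T \<in> set xs" using xs(3) by (simp add: A_def)
    then obtain p where "p < length xs" "xs ! p = T"
      unfolding in_set_conv_nth by blast
    then have "T \<le> xs ! n" using sorted_nth_mono[OF xs(1), of p n] len by simp
    moreover have "xs ! n \<in> A" using nth_mem[of n xs] len xs(3) by auto
    ultimately show ?thesis using sub by force
  qed
  have gap: "\<not> (xs ! l < x \<and> x < xs ! Suc l)" if "l < n" "x \<in> A" for l x
    using sorted_distinct_consecutive[OF xs(1,2)] that len xs(3) by auto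
  show thesis
  proof (rule that[of "\<lambda>l. xs ! l" n])
    show "xs ! l < xs ! Suc l" if "l < n" for l
      using sorted_nth_mono[OF xs(1), of l "Suc l"] nth_eq_iff_index_eq[OF xs(2), of l "Suc l"] that len
      by force
    show "xs ! Suc l - xs ! l \<le> \<delta>" if l: "l < n" for l
    proof (rule ccontr)
      assume "\<not> ?thesis"
      then have big: "xs ! l + \<delta> < xs ! Suc l" by simp
      have mem: "xs ! l \<in> A" "xs ! Suc l \<in> A"
        using nth_mem[of l xs] nth_mem[of "Suc l" xs] l len xs(3) by auto
      then have rng: "0 \<le> xs ! l" "xs ! Suc l \<le> T" using sub by auto
      \<comment> \<open>\<open>i\<close> indexes the first multiple of \<delta> strictly above
        \<open>xs ! l\<close>. It is at most \<open>xs ! l + \<delta>\<close>, so a longer cell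
        would have it in its interior.\<close>
      define i where "i = Suc (nat \<lfloor>xs ! l / \<delta>\<rfloor>)"
      have fl: "real_of_int \<lfloor>xs ! l / \<delta>\<rfloor> \<le> xs ! l / \<delta>" "xs ! l / \<delta> < real_of_int \<lfloor>xs ! l / \<delta>\<rfloor> + 1"
        by linarith+
      have i: "real i = real_of_int \<lfloor>xs ! l / \<delta>\<rfloor> + 1"
        using rng \<delta> by (simp add: i_def)
      have lo: "xs ! l < real i * \<delta>"
        using pos_divide_less_eq[OF \<delta>, THEN iffD1, OF fl(2)] unfolding i by simp
      have hi: "real i * \<delta> \<le> xs ! l + \<delta>"
        using pos_le_divide_eq[OF \<delta>, THEN iffD1, OF fl(1)] unfolding i by (simp add: algebra_simps)
      have "real i * \<delta> \<le> T" using hi big rng by simp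
      then have "real i \<le> T / \<delta>" using \<delta> by (simp add: field_simps)
      then have "i \<le> nat \<lceil>T / \<delta>\<rceil>" by linarith
      then have "real i * \<delta> \<in> A" using lo hi big rng by (auto simp: A_def)
      then show False using gap[OF l] lo hi big by force
    qed
    show "\<not> (xs ! l < q \<and> q < xs ! Suc l)" if l: "l < n" and q: "q \<in> Q" for l q
    proof
      assume *: "xs ! l < q \<and> q < xs ! Suc l"
      have mem: "xs ! l \<in> A" "xs ! Suc l \<in> A"
        using nth_mem[of l xs] nth_mem[of "Suc l" xs] l len xs(3) by auto
      then have "q \<in> A" using * q sub by (force simp: A_def)
      then show False using gap[OF l] * by blast
    qed
  qed (use first last in auto)
qed

text \<open>Conditions on all times of an interval are tested at its rational times, where they
  become countable conjunctions and hence measurable; this carries them back to real times. With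
  \<open>a < b\<close>, rationals of the interval accumulate at each of its points, endpoints
  included.\<close>

lemma continuous_le_on_rationals:
  fixes \<phi> :: "real \<Rightarrow> real"
  assumes cont: "continuous_on {a..b} \<phi>" and ab: "a < b"
    and le: "\<And>s. s \<in> \<rat> \<Longrightarrow> s \<in> {a..b} \<Longrightarrow> \<phi> s \<le> c" and t: "t \<in> {a..b}"
  shows "\<phi> t \<le> c"
proof (rule ccontr)
  assume "\<not> \<phi> t \<le> c"
  then have "0 < \<phi> t - c" by simp
  then obtain d where d: "0 < d" "\<And>s. s \<in> {a..b} \<Longrightarrow> dist s t < d \<Longrightarrow> dist (\<phi> s) (\<phi> t) < \<phi> t - c"
    using cont t unfolding continuous_on_iff by meson
  have "max a (t - d) < min b (t + d)" using ab t d(1) by auto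
  then obtain q where q: "q \<in> \<rat>" "max a (t - d) < q" "q < min b (t + d)"
    using Rats_dense_in_real by blast
  then have "q \<in> {a..b}" "dist q t < d" by (auto simp: dist_real_def)
  then show False using le[of q] d(2)[of q] q(1) by (auto simp: dist_real_def)
qed

lemma continuous_on_rationals_eq:
  fixes \<phi> \<psi> :: "real \<Rightarrow> 'a::real_normed_vector"
  assumes "continuous_on {a..b} \<phi>" "continuous_on {a..b} \<psi>" "a < b"
    and "\<And>s. s \<in> \<rat> \<Longrightarrow> s \<in> {a..b} \<Longrightarrow> \<phi> s = \<psi> s" and "t \<in> {a..b}"
  shows "\<phi> t = \<psi> t"
proof -
  have "norm (\<phi> t - \<psi> t) \<le> 0"
    by (rule continuous_le_on_rationals[where \<phi>="\<lambda>t. norm (\<phi> t - \<psi> t)" and a=a and b=b])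
       (use assms in \<open>auto intro!: continuous_intros\<close>)
  then show ?thesis by simp
qed

section \<open>Discrete energy estimate for a Brownian motion\<close>

locale brownian_filtration = prob_space P for P :: "'w measure" +
  fixes F :: "real \<Rightarrow> 'w measure" and W :: "real \<Rightarrow> 'w \<Rightarrow> real"
  assumes usual: "usual_filtered_prob_space P F"
    and BM: "brownian_motion P F W"
begin

lemma space_F: "0 \<le> t \<Longrightarrow> space (F t) = space P"
  and sets_F: "0 \<le> t \<Longrightarrow> sets (F t) \<subseteq> sets P"
  and sets_F_mono: "0 \<le> s \<Longrightarrow> s \<le> t \<Longrightarrow> sets (F s) \<subseteq> sets (F t)"
  using usual by (auto simp: usual_filtered_prob_space_def subalgebra_def)

lemma measurable_F_P: "f \<in> measurable (F t) N \<Longrightarrow> 0 \<le> t \<Longrightarrow> f \<in> measurable P N"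
  using measurable_mono[of N N "F t" P] space_F sets_F by auto

lemma measurable_F_mono:
  "f \<in> measurable (F s) N \<Longrightarrow> 0 \<le> s \<Longrightarrow> s \<le> t \<Longrightarrow> f \<in> measurable (F t) N"
  using measurable_mono[of N N "F s" "F t"] space_F[of s] space_F[of t] sets_F_mono by auto

lemma W_measurable: "0 \<le> t \<Longrightarrow> W t \<in> borel_measurable (F t)"
  using BM by (auto simp: brownian_motion_def adapted_process_def)

lemma increment_measurable:
  "0 \<le> s \<Longrightarrow> s \<le> t \<Longrightarrow> (\<lambda>\<omega>. W t \<omega> - W s \<omega>) \<in> borel_measurable (F t)"
  using W_measurable[of t] measurable_F_mono[OF W_measurable[of s], of t] by auto

context
  fixes s t :: real
  assumes st: "0 \<le> s" "s < t"
begin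

lemma increment_distributed:
  "distributed P lborel (\<lambda>\<omega>. W t \<omega> - W s \<omega>) (normal_density 0 (sqrt (t - s)))"
  using BM st by (auto simp: brownian_motion_def)

lemma increment_integrable: "integrable P (\<lambda>\<omega>. W t \<omega> - W s \<omega>)"
  using distributed_integrable_var[OF increment_distributed] st
    integrable_normal_moment_nz_1[of "sqrt (t - s)" 0] by auto

lemma increment_expectation: "expectation (\<lambda>\<omega>. W t \<omega> - W s \<omega>) = 0"
  using normal_distributed_expectation[OF _ increment_distributed] st by simp

lemma increment_square_integrable: "integrable P (\<lambda>\<omega>. (W t \<omega> - W s \<omega>)\<^sup>2)"
  using distributed_integrable[OF increment_distributed, of "\<lambda>x. x\<^sup>2"] st
    integrable_normal_moment[of "sqrt (t - s)" 0 2] by simp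

lemma increment_second_moment: "expectation (\<lambda>\<omega>. (W t \<omega> - W s \<omega>)\<^sup>2) = t - s"
  using normal_distributed_variance[OF _ increment_distributed] st
  by (simp add: increment_expectation)

lemma increment_indep:
  assumes \<xi>: "\<xi> \<in> borel_measurable (F s)"
  shows "indep_var borel \<xi> borel (\<lambda>\<omega>. W t \<omega> - W s \<omega>)"
proof -
  let ?D = "\<lambda>\<omega>. W t \<omega> - W s \<omega>"
  have ind: "indep_set (sets (F s)) (sets (vimage_algebra (space P) ?D borel))"
    using BM st by (auto simp: brownian_motion_def)
  have "\<xi> \<in> borel_measurable P"
    using measurable_F_P[OF \<xi>] st by auto
  moreover have "?D \<in> borel_measurable P"
    using measurable_F_P[OF increment_measurable] st by auto
  moreover have "{\<xi> -` A \<inter> space P | A. A \<in> sets borel} \<subseteq> sets (F s)"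
    using measurable_sets[OF \<xi>] space_F st by auto
  then have "sigma_sets (space P) {\<xi> -` A \<inter> space P | A. A \<in> sets borel} \<subseteq> sets (F s)"
    using sets.sigma_sets_subset[of _ "F s"] space_F st by simp
  moreover have "sigma_sets (space P) {?D -` A \<inter> space P | A. A \<in> sets borel}
      \<subseteq> sets (vimage_algebra (space P) ?D borel)"
    by (simp add: sets_vimage_algebra)
  ultimately show ?thesis
    unfolding indep_var_eq using ind unfolding indep_set_def
    by (auto elim!: indep_sets_mono_sets split: bool.splits dest: subsetD)
qed

text \<open>Scalar factors suffice: in the energy step the vectors enter only through
  \<open>inner (Z \<omega>) (\<eta> \<omega>)\<close> and
  \<open>(norm (\<eta> \<omega>))\<^sup>2\<close>.\<close>

lemma increment_orthogonal:
  assumes "\<xi> \<in> borel_measurable (F s)" "integrable P \<xi>"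
  shows "integrable P (\<lambda>\<omega>. \<xi> \<omega> * (W t \<omega> - W s \<omega>))"
    and "expectation (\<lambda>\<omega>. \<xi> \<omega> * (W t \<omega> - W s \<omega>)) = 0"
  using indep_var_integrable[OF increment_indep[OF assms(1)] assms(2) increment_integrable]
    indep_var_lebesgue_integral[OF increment_indep[OF assms(1)] assms(2) increment_integrable]
  by (simp_all add: increment_expectation)

lemma increment_isometry:
  fixes \<xi> :: "'w \<Rightarrow> real"
  assumes "\<xi> \<in> borel_measurable (F s)" "integrable P \<xi>"
  shows "integrable P (\<lambda>\<omega>. \<xi> \<omega> * (W t \<omega> - W s \<omega>)\<^sup>2)"
    and "expectation (\<lambda>\<omega>. \<xi> \<omega> * (W t \<omega> - W s \<omega>)\<^sup>2) = expectation (\<lambda>\<omega>. \<xi> \<omega> * (t - s))"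
proof -
  have ind: "indep_var borel \<xi> borel (\<lambda>\<omega>. (W t \<omega> - W s \<omega>)\<^sup>2)"
    using indep_var_compose[OF increment_indep[OF assms(1)], of "\<lambda>x. x" borel "\<lambda>x. x\<^sup>2" borel]
    by (simp add: o_def)
  show "integrable P (\<lambda>\<omega>. \<xi> \<omega> * (W t \<omega> - W s \<omega>)\<^sup>2)"
    using indep_var_integrable[OF ind assms(2) increment_square_integrable] .
  show "expectation (\<lambda>\<omega>. \<xi> \<omega> * (W t \<omega> - W s \<omega>)\<^sup>2) = expectation (\<lambda>\<omega>. \<xi> \<omega> * (t - s))"
    using indep_var_lebesgue_integral[OF ind assms(2) increment_square_integrable]
    by (simp add: increment_second_moment)
qed

end


text \<open>When the square is expanded, \<open>2 * inner (Z \<omega>) (\<eta> \<omega>)\<close>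
  times the Brownian increment is centred by independence, and the squared increment has mean t - s.
  As \<beta> is only \<open>F t\<close>-measurable, its product with the increment has no known
  mean; (x + y)^2 \<le> 2 x^2 + 2 y^2 avoids it and causes the factors 2 before the squares in
  \<open>q\<close>.\<close>

lemma energy_step:
  fixes Z \<eta> \<beta> :: "'w \<Rightarrow> 'e::{real_inner, second_countable_topology}"
  assumes st: "0 \<le> s" "s < t"
    and Z: "Z \<in> borel_measurable (F s)" "integrable P (\<lambda>\<omega>. (norm (Z \<omega>))\<^sup>2)"
    and D: "D \<in> sets (F s)"
    and \<eta>: "\<eta> \<in> borel_measurable (F s)" "\<And>\<omega>. \<omega> \<in> space P \<Longrightarrow> norm (\<eta> \<omega>) \<le> c"
    and \<beta>: "\<beta> \<in> borel_measurable (F t)" "\<And>\<omega>. \<omega> \<in> space P \<Longrightarrow> norm (\<beta> \<omega>) \<le> c'"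
  defines "Z' \<equiv> \<lambda>\<omega>. Z \<omega> + indicat_real D \<omega> *\<^sub>R (\<beta> \<omega> + (W t \<omega> - W s \<omega>) *\<^sub>R \<eta> \<omega>)"
    and "q \<equiv> \<lambda>\<omega>. indicat_real D \<omega> * (2 * inner (Z \<omega>) (\<beta> \<omega>) + 2 * (norm (\<beta> \<omega>))\<^sup>2
      + 2 * (t - s) * (norm (\<eta> \<omega>))\<^sup>2)"
  shows "Z' \<in> borel_measurable (F t)" "integrable P (\<lambda>\<omega>. (norm (Z' \<omega>))\<^sup>2)" "integrable P q"
    and "expectation (\<lambda>\<omega>. (norm (Z' \<omega>))\<^sup>2) \<le> expectation (\<lambda>\<omega>. (norm (Z \<omega>))\<^sup>2) + expectation q"
proof -
  let ?D = "\<lambda>\<omega>. W t \<omega> - W s \<omega>"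
  have t: "0 \<le> t" using st by simp
  have DP[measurable]: "D \<in> sets P" using D sets_F st by auto
  have Dt[measurable]: "D \<in> sets (F t)" using D sets_F_mono[of s t] st by auto
  note [measurable] = D
  have [measurable]: "Z \<in> borel_measurable P" "\<eta> \<in> borel_measurable P" "\<beta> \<in> borel_measurable P"
    "?D \<in> borel_measurable P"
    using measurable_F_P[OF Z(1)] measurable_F_P[OF \<eta>(1)] measurable_F_P[OF \<beta>(1)]
      measurable_F_P[OF increment_measurable[of s t]] st t by auto
  have [measurable]: "?D \<in> borel_measurable (F t)" "Z \<in> borel_measurable (F t)" "\<eta> \<in> borel_measurable (F t)"
    using increment_measurable[of s t] measurable_F_mono[of _ s _ t] Z(1) \<eta>(1) st by auto
  note [measurable] = \<beta>(1)
  show Z'F: "Z' \<in> borel_measurable (F t)"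
    unfolding Z'_def by measurable
  then have [measurable]: "Z' \<in> borel_measurable P"
    using measurable_F_P t by blast
  have Zint: "integrable P (\<lambda>\<omega>. norm (Z \<omega>))"
  proof (rule Bochner_Integration.integrable_bound)
    show "integrable P (\<lambda>\<omega>. 1 + (norm (Z \<omega>))\<^sup>2)" using Z(2) by simp
    have "norm (Z \<omega>) \<le> 1 + (norm (Z \<omega>))\<^sup>2" for \<omega>
      using sum_squares_bound[of 1 "norm (Z \<omega>)"] norm_ge_zero[of "Z \<omega>"]
      unfolding power_one by linarith
    then show "AE \<omega> in P. norm (norm (Z \<omega>)) \<le> norm (1 + (norm (Z \<omega>))\<^sup>2)" by auto
  qed measurable
  have inner_int: "integrable P (\<lambda>\<omega>. inner (Z \<omega>) (v \<omega>))"
    if [measurable]: "v \<in> borel_measurable P" and v: "\<And>\<omega>. \<omega> \<in> space P \<Longrightarrow> norm (v \<omega>) \<le> C" for v C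
  proof (rule Bochner_Integration.integrable_bound)
    show "integrable P (\<lambda>\<omega>. C * norm (Z \<omega>))" using Zint by simp
    show "AE \<omega> in P. norm (inner (Z \<omega>) (v \<omega>)) \<le> norm (C * norm (Z \<omega>))"
    proof (rule AE_I2)
      fix \<omega> assume \<omega>: "\<omega> \<in> space P"
      have "\<bar>inner (Z \<omega>) (v \<omega>)\<bar> \<le> norm (Z \<omega>) * norm (v \<omega>)" by (rule Cauchy_Schwarz_ineq2)
      also have "\<dots> \<le> C * norm (Z \<omega>)"
        using v[OF \<omega>] mult_right_mono[of "norm (v \<omega>)" C "norm (Z \<omega>)"] by (simp add: mult.commute)
      finally show "norm (inner (Z \<omega>) (v \<omega>)) \<le> norm (C * norm (Z \<omega>))" by auto
    qed
  qed measurable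
  have sq_int: "integrable P (\<lambda>\<omega>. (norm (v \<omega>))\<^sup>2)"
    if [measurable]: "v \<in> borel_measurable P" and v: "\<And>\<omega>. \<omega> \<in> space P \<Longrightarrow> norm (v \<omega>) \<le> C"
    for v :: "'w \<Rightarrow> 'e" and C
  proof (rule integrable_const_bound)
    show "AE \<omega> in P. norm ((norm (v \<omega>))\<^sup>2) \<le> C\<^sup>2"
      using v by (auto intro!: power_mono)
  qed measurable
  have ind_int: "integrable P (\<lambda>\<omega>. indicat_real D \<omega> * y \<omega>)" if "integrable P y" for y :: "'w \<Rightarrow> real"
    using integrable_mult_indicator[OF DP that] by simp
  have q_int: "integrable P q"
    unfolding q_def
    by (intro ind_int Bochner_Integration.integrable_add integrable_mult_right inner_int[OF _ \<beta>(2)]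
        sq_int[OF _ \<beta>(2)] sq_int[OF _ \<eta>(2)]) auto
  then show "integrable P q" .
  let ?m = "\<lambda>\<omega>. (indicat_real D \<omega> * (2 * inner (Z \<omega>) (\<eta> \<omega>))) * ?D \<omega>"
  let ?x = "\<lambda>\<omega>. indicat_real D \<omega> * (2 * (norm (\<eta> \<omega>))\<^sup>2)"
  let ?v = "\<lambda>\<omega>. ?x \<omega> * (?D \<omega>)\<^sup>2"
  note [measurable] = Z(1) \<eta>(1)
  have m: "integrable P ?m" "expectation ?m = 0"
    by (intro increment_orthogonal[OF st] ind_int integrable_mult_right inner_int[OF _ \<eta>(2)]; measurable)+
  have x_int: "integrable P ?x"
    by (intro ind_int integrable_mult_right sq_int[OF _ \<eta>(2)]) auto
  have v: "integrable P ?v" "expectation ?v = expectation (\<lambda>\<omega>. ?x \<omega> * (t - s))"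
    by (intro increment_isometry[OF st] x_int; measurable)+
  \<comment> \<open>\<open>?r\<close> is \<open>(norm (Z \<omega>))\<^sup>2 + q \<omega>\<close>
    with t - s replaced by the squared increment and the centred term added. It dominates the new
    square pathwise, while neither change alters the expectation.\<close>
  let ?r = "\<lambda>\<omega>. (norm (Z \<omega>))\<^sup>2 + (q \<omega> - ?x \<omega> * (t - s)) + ?m \<omega> + ?v \<omega>"
  have r_int: "integrable P ?r"
    using Z(2) q_int x_int m v by (intro Bochner_Integration.integrable_add Bochner_Integration.integrable_diff) auto
  have le: "(norm (Z' \<omega>))\<^sup>2 \<le> ?r \<omega>" for \<omega>
  proof (cases "\<omega> \<in> D")
    case True
    let ?b = "\<beta> \<omega>" and ?h = "?D \<omega> *\<^sub>R \<eta> \<omega>"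
    have eq: "(norm (Z' \<omega>))\<^sup>2 = (norm (Z \<omega>))\<^sup>2 + 2 * inner (Z \<omega>) (?b + ?h) + (norm (?b + ?h))\<^sup>2"
      using True by (simp add: Z'_def power2_norm_eq_inner inner_add_left inner_add_right inner_commute)
    have "(norm (?b + ?h))\<^sup>2 \<le> (norm ?b + norm ?h)\<^sup>2"
      by (intro power_mono norm_triangle_ineq) auto
    also have "\<dots> \<le> 2 * (norm ?b)\<^sup>2 + 2 * (norm ?h)\<^sup>2"
      using sum_squares_bound[of "norm ?b" "norm ?h"] by (simp add: power2_sum)
    also have "(norm ?h)\<^sup>2 = (norm (\<eta> \<omega>))\<^sup>2 * (?D \<omega>)\<^sup>2"
      by (simp add: power_mult_distrib)
    finally show ?thesis
      using True unfolding eq q_def by (simp add: inner_add_right algebra_simps)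
  next
    case False
    then show ?thesis by (simp add: Z'_def q_def)
  qed
  show Z'int: "integrable P (\<lambda>\<omega>. (norm (Z' \<omega>))\<^sup>2)"
  proof (rule Bochner_Integration.integrable_bound[OF r_int])
    show "AE \<omega> in P. norm ((norm (Z' \<omega>))\<^sup>2) \<le> norm (?r \<omega>)"
      using le by (intro AE_I2) (smt (verit) real_norm_def zero_le_power2)
  qed measurable
  have "expectation (\<lambda>\<omega>. (norm (Z' \<omega>))\<^sup>2) \<le> expectation ?r"
    using le by (intro integral_mono Z'int r_int)
  also have "\<dots> = expectation (\<lambda>\<omega>. (norm (Z \<omega>))\<^sup>2) + expectation q"
    using Z(2) q_int x_int m v by simp
  finally show "expectation (\<lambda>\<omega>. (norm (Z' \<omega>))\<^sup>2) \<le> expectation (\<lambda>\<omega>. (norm (Z \<omega>))\<^sup>2) + expectation q" .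
qed

text \<open>The hypothesis \<open>bound\<close> concerns partial sums, not single cells, because the
  errors are small only in total: the approximation error may sit in any cell, and the exit cell is
  random. Expectations of the partial sums then have the form required by the discrete Gronwall
  inequality.\<close>

lemma energy_estimate:
  fixes \<eta> \<beta> :: "nat \<Rightarrow> 'w \<Rightarrow> 'e::{real_inner, second_countable_topology}"
  assumes u: "0 \<le> u 0" "\<And>l. l < n \<Longrightarrow> u l < u (Suc l)"
    and D: "\<And>l. l < n \<Longrightarrow> D l \<in> sets (F (u l))"
    and \<eta>: "\<And>l. l < n \<Longrightarrow> \<eta> l \<in> borel_measurable (F (u l))"
      "\<And>l \<omega>. l < n \<Longrightarrow> \<omega> \<in> space P \<Longrightarrow> norm (\<eta> l \<omega>) \<le> c"
    and \<beta>: "\<And>l. l < n \<Longrightarrow> \<beta> l \<in> borel_measurable (F (u (Suc l)))"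
      "\<And>l \<omega>. l < n \<Longrightarrow> \<omega> \<in> space P \<Longrightarrow> norm (\<beta> l \<omega>) \<le> c'"
  defines "Z \<equiv> \<lambda>l \<omega>. \<Sum>i<l. indicat_real (D i) \<omega> *\<^sub>R
      (\<beta> i \<omega> + (W (u (Suc i)) \<omega> - W (u i) \<omega>) *\<^sub>R \<eta> i \<omega>)"
  assumes bound: "\<And>l. l \<le> n \<Longrightarrow> AE \<omega> in P. (\<Sum>i<l. indicat_real (D i) \<omega> * (2 * inner (Z i \<omega>) (\<beta> i \<omega>)
        + 2 * (norm (\<beta> i \<omega>))\<^sup>2 + 2 * (u (Suc i) - u i) * (norm (\<eta> i \<omega>))\<^sup>2))
      \<le> (\<Sum>i<l. a * ((u (Suc i) - u i) * (norm (Z i \<omega>))\<^sup>2)) + \<kappa>"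
    and a: "0 \<le> a" and \<kappa>: "0 \<le> \<kappa>"
  shows "Z n \<in> borel_measurable (F (u n))" "integrable P (\<lambda>\<omega>. (norm (Z n \<omega>))\<^sup>2)"
    and "expectation (\<lambda>\<omega>. (norm (Z n \<omega>))\<^sup>2) \<le> \<kappa> * exp (a * (u n - u 0))"
proof -
  let ?q = "\<lambda>l \<omega>. indicat_real (D l) \<omega> * (2 * inner (Z l \<omega>) (\<beta> l \<omega>)
        + 2 * (norm (\<beta> l \<omega>))\<^sup>2 + 2 * (u (Suc l) - u l) * (norm (\<eta> l \<omega>))\<^sup>2)"
  let ?E = "\<lambda>l. expectation (\<lambda>\<omega>. (norm (Z l \<omega>))\<^sup>2)"
  have ul: "0 \<le> u l" if "l \<le> n" for l
    using that
  proof (induction l)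
    case (Suc l)
    then show ?case using u(2)[of l] by simp
  qed (use u in simp)
  have Z0: "Z 0 = (\<lambda>\<omega>. 0)" by (simp add: Z_def)
  have ZSuc: "Z (Suc l) = (\<lambda>\<omega>. Z l \<omega> + indicat_real (D l) \<omega> *\<^sub>R
      (\<beta> l \<omega> + (W (u (Suc l)) \<omega> - W (u l) \<omega>) *\<^sub>R \<eta> l \<omega>))" for l
    unfolding Z_def by (simp only: sum.lessThan_Suc)
  \<comment> \<open>Integrability is carried through the induction: \<open>energy_step\<close> needs
    a square-integrable \<open>Z l\<close> before it can add a cell.\<close>
  have main: "Z l \<in> borel_measurable (F (u l)) \<and> integrable P (\<lambda>\<omega>. (norm (Z l \<omega>))\<^sup>2) \<and>
      (\<forall>i<l. integrable P (?q i)) \<and> ?E l \<le> (\<Sum>i<l. expectation (?q i))" if "l \<le> n" for l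
    using that
  proof (induction l)
    case 0
    then show ?case by (simp add: Z0)
  next
    case (Suc l)
    then have l: "l < n" and IH: "Z l \<in> borel_measurable (F (u l))"
        "integrable P (\<lambda>\<omega>. (norm (Z l \<omega>))\<^sup>2)" "\<forall>i<l. integrable P (?q i)"
        "?E l \<le> (\<Sum>i<l. expectation (?q i))"
      by auto
    note step = energy_step[OF ul u(2)[OF l] IH(1,2) D[OF l] \<eta>(1)[OF l] \<eta>(2)[OF l] \<beta>(1)[OF l] \<beta>(2)[OF l]]
    show ?case
      using step IH(3,4) l unfolding ZSuc by (auto simp: less_Suc_eq)
  qed
  then show "Z n \<in> borel_measurable (F (u n))" "integrable P (\<lambda>\<omega>. (norm (Z n \<omega>))\<^sup>2)" by auto
  have "?E l \<le> \<kappa> + a * (\<Sum>i<l. (u (Suc i) - u i) * ?E i)" if l: "l \<le> n" for l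
  proof -
    have sq: "integrable P (\<lambda>\<omega>. (norm (Z i \<omega>))\<^sup>2)" if "i < l" for i
      using main[of i] that l by auto
    have "?E l \<le> (\<Sum>i<l. expectation (?q i))" using main[OF l] by blast
    also have "\<dots> = expectation (\<lambda>\<omega>. \<Sum>i<l. ?q i \<omega>)"
      using main[OF l] by (subst Bochner_Integration.integral_sum) auto
    also have "\<dots> \<le> expectation (\<lambda>\<omega>. (\<Sum>i<l. a * ((u (Suc i) - u i) * (norm (Z i \<omega>))\<^sup>2)) + \<kappa>)"
      using main[OF l] sq
      by (intro integral_mono_AE bound[OF l] Bochner_Integration.integrable_sum
          Bochner_Integration.integrable_add integrable_mult_right) auto
    also have "\<dots> = (\<Sum>i<l. a * ((u (Suc i) - u i) * ?E i)) + \<kappa>"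
      using sq by (subst Bochner_Integration.integral_add, auto simp: prob_space)
    finally show ?thesis by (simp add: sum_distrib_left)
  qed
  then have "?E n \<le> \<kappa> * exp (a * (\<Sum>i<n. u (Suc i) - u i))"
    by (rule discrete_gronwall[where a="?E" and \<delta>="\<lambda>i. u (Suc i) - u i"]) (use a \<kappa> u(2) in \<open>auto intro: less_imp_le\<close>)
  then show "?E n \<le> \<kappa> * exp (a * (u n - u 0))"
    by (simp add: sum_lessThan_telescope)
qed

end

section \<open>Pathwise bound of the energy increments\<close>

text \<open>For decreasing \<open>d\<close> the terms kept are those before the last index at which
  \<open>d\<close> holds, and the assumed bound applies at that index. It serves for the
  approximation error, which is controlled only while the scheme runs.\<close>

lemma sum_antimono_indicator_le:
  fixes q :: "nat \<Rightarrow> real"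
  assumes "\<And>l. l \<le> n \<Longrightarrow> d l \<Longrightarrow> (\<Sum>i<l. q i) \<le> \<epsilon>"
    and "\<And>l i. l \<le> n \<Longrightarrow> d l \<Longrightarrow> i \<le> l \<Longrightarrow> d i" and "0 \<le> \<epsilon>" and "l \<le> n"
  shows "(\<Sum>i<l. if d (Suc i) then q i else 0) \<le> \<epsilon>"
  using assms(4)
proof (induction l)
  case 0
  then show ?case using assms(3) by simp
next
  case (Suc l)
  show ?case
  proof (cases "d (Suc l)")
    case True
    then have "(\<Sum>i<Suc l. if d (Suc i) then q i else 0) = (\<Sum>i<Suc l. q i)"
      using assms(2)[OF Suc.prems True] by (intro sum.cong) auto
    then show ?thesis using assms(1)[OF Suc.prems True] by simp
  qed (use Suc in simp)
qed

text \<open>A decreasing \<open>d\<close> switches from true to false at most once. Recording on the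
  right whether the switch has happened makes the induction close.\<close>

lemma sum_exit_le:
  fixes \<kappa> :: real
  assumes "\<And>i. i < n \<Longrightarrow> d (Suc i) \<Longrightarrow> d i" and "0 \<le> \<kappa>" and "l \<le> n"
  shows "(\<Sum>i<l. if d i \<and> \<not> d (Suc i) then \<kappa> else 0) \<le> (if d l then 0 else \<kappa>)"
  using assms(3) by (induction l) (use assms(1,2) in \<open>force\<close>)+

lemma norm_diff_sq_bound:
  fixes y z :: "'a::real_normed_vector"
  assumes "norm (y - z) \<le> e"
  shows "(norm y)\<^sup>2 \<le> 2 * (norm z)\<^sup>2 + 2 * e\<^sup>2"
proof -
  have "norm y \<le> norm z + e" using assms norm_triangle_ineq2[of y z] by simp
  then have "(norm y)\<^sup>2 \<le> (norm z + e)\<^sup>2" by (intro power_mono) auto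
  also have "\<dots> \<le> 2 * (norm z)\<^sup>2 + 2 * e\<^sup>2"
    using sum_squares_bound[of "norm z" e] by (simp add: power2_sum)
  finally show ?thesis .
qed

text \<open>Here \<eta> is the constant value of the elementary integrand on the cell and
  \<open>S\<close> the true integrand; \<eta> is split into \<open>S\<close> and the error, and the
  squares are integrated. Finiteness is required since \<open>enn2real\<close> sends infinity to
  0.\<close>

lemma cell_square_bound:
  fixes S :: "real \<Rightarrow> 'e::{real_normed_vector, second_countable_topology}"
  assumes [measurable]: "S \<in> borel_measurable borel" and ab: "a \<le> b"
    and S: "\<And>r. r \<in> {a<..b} \<Longrightarrow> (norm (S r))\<^sup>2 \<le> B" and B: "0 \<le> B"
    and fin: "(\<integral>\<^sup>+r\<in>{a<..b}. ennreal ((norm (\<eta> - S r))\<^sup>2) \<partial>lborel) < \<infinity>"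
  shows "(b - a) * (norm \<eta>)\<^sup>2
    \<le> 2 * (b - a) * B + 2 * enn2real (\<integral>\<^sup>+r\<in>{a<..b}. ennreal ((norm (\<eta> - S r))\<^sup>2) \<partial>lborel)"
    (is "_ \<le> _ + 2 * enn2real ?Q")
proof -
  have pt: "(norm \<eta>)\<^sup>2 \<le> 2 * B + 2 * (norm (\<eta> - S r))\<^sup>2" if "r \<in> {a<..b}" for r
    using norm_diff_sq_bound[of \<eta> "S r" "norm (\<eta> - S r)"] S[OF that] by simp
  have "ennreal ((b - a) * (norm \<eta>)\<^sup>2) = (\<integral>\<^sup>+r\<in>{a<..b}. ennreal ((norm \<eta>)\<^sup>2) \<partial>lborel)"
    using ab by (subst nn_integral_cmult_indicator) (auto simp: ennreal_mult[symmetric] mult.commute)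
  also have "\<dots> \<le> (\<integral>\<^sup>+r. ennreal (2 * B) * indicator {a<..b} r
      + ennreal 2 * (ennreal ((norm (\<eta> - S r))\<^sup>2) * indicator {a<..b} r) \<partial>lborel)"
  proof (rule nn_integral_mono)
    fix r
    have "ennreal ((norm \<eta>)\<^sup>2) \<le> ennreal (2 * B) + ennreal 2 * ennreal ((norm (\<eta> - S r))\<^sup>2)"
      if "r \<in> {a<..b}"
      using ennreal_leI[OF pt[OF that]] B by (simp add: ennreal_mult)
    then show "ennreal ((norm \<eta>)\<^sup>2) * indicator {a<..b} r \<le> ennreal (2 * B) * indicator {a<..b} r
      + ennreal 2 * (ennreal ((norm (\<eta> - S r))\<^sup>2) * indicator {a<..b} r)"
      by (simp add: indicator_def)
  qed
  also have "\<dots> = ennreal (2 * B) * ennreal (b - a) + ennreal 2 * ?Q"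
    using ab by (simp add: nn_integral_add nn_integral_cmult nn_integral_cmult_indicator)
  also have "?Q = ennreal (enn2real ?Q)" using fin by simp
  also have "ennreal (2 * B) * ennreal (b - a) + ennreal 2 * ennreal (enn2real ?Q)
      = ennreal (2 * B * (b - a) + 2 * enn2real ?Q)"
    using ab B by (simp add: ennreal_mult)
  finally show ?thesis
    using ab B by (subst (asm) ennreal_le_iff) (auto simp: mult_ac)
qed

lemma cell_integral_bounds:
  fixes V :: "real \<Rightarrow> 'e::{real_inner, banach, second_countable_topology}"
  assumes [measurable]: "V \<in> borel_measurable borel" and ab: "a \<le> b"
    and V: "\<And>r. norm (V r) \<le> K"
  shows "norm (LINT r:{a..b}|lborel. V r) \<le> K * (b - a)"
    and "(\<And>r. r \<in> {a..b} \<Longrightarrow> inner z (V r) \<le> B) \<Longrightarrow> inner z (LINT r:{a..b}|lborel. V r) \<le> B * (b - a)"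
proof -
  have Vint: "set_integrable lborel {a..b} V"
    unfolding set_integrable_def
  proof (rule integrableI_bounded_set_indicator[where B=K])
    show "emeasure lborel {a..b} < \<infinity>" using ab by simp
  qed (use V in auto)
  have const: "set_integrable lborel {a..b} (\<lambda>r. B)" "(LINT r:{a..b}|lborel. B) = B * (b - a)" for B :: real
    using ab by (simp_all add: set_integrable_def set_lebesgue_integral_def)
  have "norm (LINT r:{a..b}|lborel. V r) \<le> (LINT r:{a..b}|lborel. norm (V r))"
    using Vint by (rule set_integral_norm_bound)
  also have "\<dots> \<le> (LINT r:{a..b}|lborel. K)"
    using V set_integrable_norm[OF Vint] const by (intro set_integral_mono) auto
  finally show "norm (LINT r:{a..b}|lborel. V r) \<le> K * (b - a)" using const by simp
  assume B: "\<And>r. r \<in> {a..b} \<Longrightarrow> inner z (V r) \<le> B"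
  have int: "set_integrable lborel {a..b} (\<lambda>r. inner z (V r))"
    and eq: "inner z (LINT r:{a..b}|lborel. V r) = (LINT r:{a..b}|lborel. inner z (V r))"
    using integrable_inner_right[of z lborel "\<lambda>r. indicat_real {a..b} r *\<^sub>R V r"]
      integral_inner_right[of z lborel "\<lambda>r. indicat_real {a..b} r *\<^sub>R V r"] Vint
    by (auto simp: set_integrable_def set_lebesgue_integral_def)
  show "inner z (LINT r:{a..b}|lborel. V r) \<le> B * (b - a)"
    unfolding eq const(2)[symmetric] using B int const by (intro set_integral_mono) auto
qed

text \<open>For one fixed path, \<open>d l\<close> says that the scheme still runs at
  \<open>u l\<close>. A term counts when \<open>d i\<close> holds, but the good properties of its
  cell are known only under \<open>d (Suc i)\<close>. The two conditions differ on at most one cell,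
  which is estimated crudely and gives the last summand, the one with factor \<delta>. On the other
  cells \<open>Y\<close> is within 2 * \<epsilon> of \<open>Z i\<close>, so the conditions on the
  coefficients, which concern \<open>Y\<close>, yield a multiple of the squared norm of
  \<open>Z i\<close> plus errors.\<close>

lemma pathwise_energy_bound:
  fixes Z \<beta> \<eta> :: "nat \<Rightarrow> 'e::{real_inner, banach, second_countable_topology}"
    and V S Y :: "real \<Rightarrow> 'e" and d :: "nat \<Rightarrow> bool"
  assumes u: "u 0 = 0" "u n = T" "\<And>l. l < n \<Longrightarrow> u l < u (Suc l)" "\<And>l. l < n \<Longrightarrow> u (Suc l) - u l \<le> \<delta>"
    and d: "\<And>l i. l \<le> n \<Longrightarrow> d l \<Longrightarrow> i \<le> l \<Longrightarrow> d i"
    and V: "V \<in> borel_measurable borel" "\<And>r. norm (V r) \<le> Cb"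
    and \<beta>: "\<And>l. l < n \<Longrightarrow> \<beta> l = (LINT r:{u l..u (Suc l)}|lborel. V r)"
    and S: "S \<in> borel_measurable borel"
    and \<eta>: "\<And>l. l < n \<Longrightarrow> norm (\<eta> l) \<le> c"
    and Z: "\<And>l. l < n \<Longrightarrow> d l \<Longrightarrow> norm (Z l) \<le> Cz"
    and near: "\<And>l r. l < n \<Longrightarrow> d (Suc l) \<Longrightarrow> r \<in> {u l..u (Suc l)} \<Longrightarrow> norm (Y r - Z l) \<le> 2 * \<epsilon>"
    and drift: "\<And>l r. l < n \<Longrightarrow> d (Suc l) \<Longrightarrow> r \<in> {u l..u (Suc l)} \<Longrightarrow> inner (V r) (Y r) \<le> \<kappa>1 * (norm (Y r))\<^sup>2"
    and diff: "\<And>l r. l < n \<Longrightarrow> d (Suc l) \<Longrightarrow> r \<in> {u l..u (Suc l)} \<Longrightarrow> norm (S r) \<le> \<kappa>2 * norm (Y r)"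
    and approx: "\<And>l. l \<le> n \<Longrightarrow> d l \<Longrightarrow>
      (\<Sum>i<l. \<integral>\<^sup>+r\<in>{u i<..u (Suc i)}. ennreal ((norm (\<eta> i - S r))\<^sup>2) \<partial>lborel) \<le> ennreal \<epsilon>"
    and pos: "0 \<le> \<epsilon>" "0 \<le> \<kappa>1" "0 \<le> \<kappa>2" "0 \<le> Cz" "0 \<le> Cb" "0 \<le> \<delta>"
    and l: "l \<le> n"
  shows "(\<Sum>i<l. if d i then 2 * inner (Z i) (\<beta> i) + 2 * (norm (\<beta> i))\<^sup>2
            + 2 * (u (Suc i) - u i) * (norm (\<eta> i))\<^sup>2 else 0)
     \<le> (\<Sum>i<l. (4 * \<kappa>1 + 8 * \<kappa>2\<^sup>2) * ((u (Suc i) - u i) * (norm (Z i))\<^sup>2))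
       + ((16 * \<kappa>1 * \<epsilon>\<^sup>2 + 4 * \<epsilon> * Cb + 2 * Cb\<^sup>2 * \<delta> + 32 * \<kappa>2\<^sup>2 * \<epsilon>\<^sup>2) * T + 4 * \<epsilon>
         + (2 * Cz * Cb + 2 * c\<^sup>2) * \<delta>)"
proof -
  define Q where "Q i = (\<integral>\<^sup>+r\<in>{u i<..u (Suc i)}. ennreal ((norm (\<eta> i - S r))\<^sup>2) \<partial>lborel)" for i
  define K1 where "K1 = 16 * \<kappa>1 * \<epsilon>\<^sup>2 + 4 * \<epsilon> * Cb + 2 * Cb\<^sup>2 * \<delta> + 32 * \<kappa>2\<^sup>2 * \<epsilon>\<^sup>2"
  define K2 where "K2 = (2 * Cz * Cb + 2 * c\<^sup>2) * \<delta>"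
  let ?h = "\<lambda>i. u (Suc i) - u i"
  have K1: "0 \<le> K1" and K2: "0 \<le> K2" using pos by (auto simp: K1_def K2_def)
  have Qfin: "Q i < \<infinity>" if "i < l" "l \<le> n" "d l" for i l
  proof -
    have "Q i \<le> (\<Sum>i<l. Q i)" using that by (intro member_le_sum) auto
    also have "\<dots> \<le> ennreal \<epsilon>" using approx[OF that(2,3)] by (simp add: Q_def)
    finally show ?thesis using order_le_less_trans by fastforce
  qed
  have Qsum: "(\<Sum>i<l. enn2real (Q i)) \<le> \<epsilon>" if "l \<le> n" "d l" for l
  proof -
    have "ennreal (\<Sum>i<l. enn2real (Q i)) = (\<Sum>i<l. ennreal (enn2real (Q i)))"
      by (rule sum_ennreal[symmetric]) auto
    also have "\<dots> = (\<Sum>i<l. Q i)"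
      using Qfin[OF _ that] by (intro sum.cong) auto
    also have "\<dots> \<le> ennreal \<epsilon>" using approx[OF that] by (simp add: Q_def)
    finally show ?thesis using pos by (simp add: sum_nonneg)
  qed
  \<comment> \<open>The four summands on the right are the Gronwall term, an error proportional to
    the length of the cell, the approximation error on a cell that the scheme survives, and the
    payment for the exit cell. The last two are small only after summation.\<close>
  have step: "(if d i then 2 * inner (Z i) (\<beta> i) + 2 * (norm (\<beta> i))\<^sup>2 + 2 * ?h i * (norm (\<eta> i))\<^sup>2 else 0)
      \<le> (4 * \<kappa>1 + 8 * \<kappa>2\<^sup>2) * (?h i * (norm (Z i))\<^sup>2) + K1 * ?h i
        + 4 * (if d (Suc i) then enn2real (Q i) else 0) + (if d i \<and> \<not> d (Suc i) then K2 else 0)"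
    (is "?L \<le> ?R") if i: "i < n" for i
  proof -
    let ?z = "(norm (Z i))\<^sup>2"
    have h: "0 < ?h i" "?h i \<le> \<delta>" using u i by auto
    have b: "norm (\<beta> i) \<le> Cb * ?h i"
      unfolding \<beta>[OF i] using h by (intro cell_integral_bounds V) auto
    have "(norm (\<beta> i))\<^sup>2 \<le> (Cb * ?h i)\<^sup>2" using b by (intro power_mono) auto
    also have "\<dots> = Cb\<^sup>2 * ?h i * ?h i" by (simp add: power2_eq_square)
    also have "\<dots> \<le> Cb\<^sup>2 * ?h i * \<delta>" using h by (intro mult_left_mono) auto
    finally have b2: "2 * (norm (\<beta> i))\<^sup>2 \<le> 2 * Cb\<^sup>2 * \<delta> * ?h i" by (simp add: mult_ac)
    consider "d (Suc i)" "d i" | "\<not> d (Suc i)" "d i" | "\<not> d i"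
      using d[of "Suc i" i] i by auto
    then show ?thesis
    proof cases
      case 1
      have y: "(norm (Y r))\<^sup>2 \<le> 2 * ?z + 8 * \<epsilon>\<^sup>2" if "r \<in> {u i..u (Suc i)}" for r
        using norm_diff_sq_bound[OF near[OF i 1(1) that]] by (simp add: power_mult_distrib)
      have "inner (Z i) (V r) \<le> \<kappa>1 * (2 * ?z + 8 * \<epsilon>\<^sup>2) + 2 * \<epsilon> * Cb" if r: "r \<in> {u i..u (Suc i)}" for r
      proof -
        \<comment> \<open>The drift condition pairs \<open>V r\<close> with \<open>Y r\<close>, the
          scheme pairs it with \<open>Z i\<close>; the exchange costs at most 2 * \<epsilon> *
          Cb.\<close>
        have "inner (Z i) (V r) = inner (V r) (Y r) + inner (Z i - Y r) (V r)"
          by (simp add: inner_diff_left inner_diff_right inner_commute)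
        also have "\<dots> \<le> \<kappa>1 * (norm (Y r))\<^sup>2 + norm (Z i - Y r) * norm (V r)"
          using drift[OF i 1(1) r] norm_cauchy_schwarz[of "Z i - Y r" "V r"] by linarith
        also have "\<dots> \<le> \<kappa>1 * (2 * ?z + 8 * \<epsilon>\<^sup>2) + 2 * \<epsilon> * Cb"
          using y[OF r] near[OF i 1(1) r] V(2)[of r] pos
          by (intro add_mono mult_left_mono mult_mono) (auto simp: norm_minus_commute)
        finally show ?thesis .
      qed
      then have A1: "inner (Z i) (\<beta> i) \<le> (\<kappa>1 * (2 * ?z + 8 * \<epsilon>\<^sup>2) + 2 * \<epsilon> * Cb) * ?h i"
        unfolding \<beta>[OF i] using h by (intro cell_integral_bounds(2)[OF V(1) _ V(2)]) auto
      have "(norm (S r))\<^sup>2 \<le> \<kappa>2\<^sup>2 * (2 * ?z + 8 * \<epsilon>\<^sup>2)" if r: "r \<in> {u i<..u (Suc i)}" for r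
      proof -
        have r': "r \<in> {u i..u (Suc i)}" using r by auto
        have "(norm (S r))\<^sup>2 \<le> (\<kappa>2 * norm (Y r))\<^sup>2"
          using diff[OF i 1(1) r'] by (intro power_mono) auto
        also have "\<dots> \<le> \<kappa>2\<^sup>2 * (2 * ?z + 8 * \<epsilon>\<^sup>2)"
          unfolding power_mult_distrib using y[OF r'] by (intro mult_left_mono) auto
        finally show ?thesis .
      qed
      then have A2: "?h i * (norm (\<eta> i))\<^sup>2 \<le> 2 * ?h i * (\<kappa>2\<^sup>2 * (2 * ?z + 8 * \<epsilon>\<^sup>2)) + 2 * enn2real (Q i)"
        unfolding Q_def using h pos Qfin[of i "Suc i"] i 1
        by (intro cell_square_bound S) (auto simp: Q_def)
      have "?L = 2 * inner (Z i) (\<beta> i) + 2 * (norm (\<beta> i))\<^sup>2 + 2 * (?h i * (norm (\<eta> i))\<^sup>2)"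
        using 1 by (simp add: mult.assoc)
      also have "\<dots> \<le> 2 * ((\<kappa>1 * (2 * ?z + 8 * \<epsilon>\<^sup>2) + 2 * \<epsilon> * Cb) * ?h i) + 2 * Cb\<^sup>2 * \<delta> * ?h i
          + 2 * (2 * ?h i * (\<kappa>2\<^sup>2 * (2 * ?z + 8 * \<epsilon>\<^sup>2)) + 2 * enn2real (Q i))"
        by (intro add_mono mult_left_mono A1 A2 b2) auto
      also have "\<dots> = ?R" using 1 by (simp add: K1_def algebra_simps)
      finally show ?thesis .
    next
      case 2
      have "inner (Z i) (\<beta> i) \<le> norm (Z i) * norm (\<beta> i)" by (rule norm_cauchy_schwarz)
      also have "\<dots> \<le> Cz * (Cb * \<delta>)"
        using Z[OF i 2(2)] b h pos mult_left_mono[of "?h i" \<delta> Cb] by (intro mult_mono) auto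
      finally have A1: "2 * inner (Z i) (\<beta> i) \<le> 2 * Cz * Cb * \<delta>" by (simp add: mult_ac)
      have A2: "?h i * (norm (\<eta> i))\<^sup>2 \<le> \<delta> * c\<^sup>2"
        using h \<eta>[OF i] by (intro mult_mono power_mono) auto
      have A3: "2 * Cb\<^sup>2 * \<delta> * ?h i \<le> K1 * ?h i"
        using h pos by (intro mult_right_mono) (auto simp: K1_def)
      have A4: "0 \<le> (4 * \<kappa>1 + 8 * \<kappa>2\<^sup>2) * (?h i * ?z)"
        using h pos by auto
      show ?thesis using 2 A1 A2 A3 A4 b2 by (simp add: K2_def algebra_simps)
    next
      case 3
      then show ?thesis using h pos K1 d[of "Suc i" i] i by auto
    qed
  qed
  have "(\<Sum>i<l. if d i then 2 * inner (Z i) (\<beta> i) + 2 * (norm (\<beta> i))\<^sup>2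
            + 2 * ?h i * (norm (\<eta> i))\<^sup>2 else 0)
      \<le> (\<Sum>i<l. (4 * \<kappa>1 + 8 * \<kappa>2\<^sup>2) * (?h i * (norm (Z i))\<^sup>2) + K1 * ?h i
        + 4 * (if d (Suc i) then enn2real (Q i) else 0) + (if d i \<and> \<not> d (Suc i) then K2 else 0))"
    using l by (intro sum_mono step) auto
  also have "\<dots> = (\<Sum>i<l. (4 * \<kappa>1 + 8 * \<kappa>2\<^sup>2) * (?h i * (norm (Z i))\<^sup>2)) + K1 * (\<Sum>i<l. ?h i)
      + 4 * (\<Sum>i<l. if d (Suc i) then enn2real (Q i) else 0) + (\<Sum>i<l. if d i \<and> \<not> d (Suc i) then K2 else 0)"
    by (simp only: sum.distrib sum_distrib_left)
  also have "\<dots> \<le> (\<Sum>i<l. (4 * \<kappa>1 + 8 * \<kappa>2\<^sup>2) * (?h i * (norm (Z i))\<^sup>2)) + K1 * T + 4 * \<epsilon> + K2"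
  proof (intro add_mono mult_left_mono order_refl K1)
    have "(\<Sum>i<l. ?h i) \<le> (\<Sum>i<n. ?h i)"
      using l u(3) by (intro sum_mono2) (auto intro: less_imp_le)
    then show "(\<Sum>i<l. ?h i) \<le> T" using u by (simp add: sum_lessThan_telescope)
    show "(\<Sum>i<l. if d (Suc i) then enn2real (Q i) else 0) \<le> \<epsilon>"
      by (rule sum_antimono_indicator_le[of n d]) (fact Qsum d pos(1) l)+
    have "(\<Sum>i<l. if d i \<and> \<not> d (Suc i) then K2 else 0) \<le> (if d l then 0 else K2)"
      by (rule sum_exit_le[OF _ K2 l], rule d[of "Suc i" i for i]) auto
    then show "(\<Sum>i<l. if d i \<and> \<not> d (Suc i) then K2 else 0) \<le> K2"
      using K2 by (auto split: if_splits)
  qed auto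
  finally show ?thesis by (simp add: K1_def K2_def)
qed

section \<open>Elementary integrands and progressive processes\<close>

text \<open>Cells and intervals of elementary integrands are both open on the left and closed on the
  right, so an interval without endpoints inside the cell contains all of it or none. The right end
  \<open>v\<close> represents the cell; the value at \<open>u\<close> may belong to the preceding
  interval.\<close>

lemma elementary_process_cell:
  assumes el: "elementary_data P F m \<tau> \<xi>"
    and no: "\<And>i. i \<le> m \<Longrightarrow> \<not> (u < \<tau> i \<and> \<tau> i < v)" and r: "r \<in> {u<..v}"
  shows "elementary_process m \<tau> \<xi> r \<omega> = elementary_process m \<tau> \<xi> v \<omega>"
  unfolding elementary_process_def
proof (intro sum.cong refl)
  fix i assume "i \<in> {..<m}"
  then have "\<tau> i \<le> \<tau> (Suc i)" "\<not> (u < \<tau> i \<and> \<tau> i < v)" "\<not> (u < \<tau> (Suc i) \<and> \<tau> (Suc i) < v)"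
    using el no[of i] no[of "Suc i"] by (auto simp: elementary_data_def)
  then show "indicat_real {\<tau> i<..\<tau> (Suc i)} r *\<^sub>R \<xi> i \<omega> = indicat_real {\<tau> i<..\<tau> (Suc i)} v *\<^sub>R \<xi> i \<omega>"
    using r by (auto simp: indicator_def)
qed

lemma elementary_integral_cell:
  assumes el: "elementary_data P F m \<tau> \<xi>"
    and no: "\<And>i. i \<le> m \<Longrightarrow> \<not> (u < \<tau> i \<and> \<tau> i < v)" and uv: "u < v"
  shows "elementary_integral W m \<tau> \<xi> v \<omega> - elementary_integral W m \<tau> \<xi> u \<omega>
    = (W v \<omega> - W u \<omega>) *\<^sub>R elementary_process m \<tau> \<xi> v \<omega>"
  unfolding elementary_process_def elementary_integral_def sum_subtractf[symmetric] scaleR_sum_right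
proof (intro sum.cong refl)
  fix i assume "i \<in> {..<m}"
  then have i: "\<tau> i \<le> \<tau> (Suc i)" "\<not> (u < \<tau> i \<and> \<tau> i < v)" "\<not> (u < \<tau> (Suc i) \<and> \<tau> (Suc i) < v)"
    using el no[of i] no[of "Suc i"] by (auto simp: elementary_data_def)
  \<comment> \<open>The interval lies before the cell, after it, or covers it; only in the last case
    do the truncations at \<open>u\<close> and \<open>v\<close> differ by the increment of
    \<open>W\<close> over the cell.\<close>
  then consider "\<tau> (Suc i) \<le> u" | "v \<le> \<tau> i" | "\<tau> i \<le> u" "v \<le> \<tau> (Suc i)" by linarith
  then show "(W (min v (\<tau> (Suc i))) \<omega> - W (min v (\<tau> i)) \<omega>) *\<^sub>R \<xi> i \<omega> -
      (W (min u (\<tau> (Suc i))) \<omega> - W (min u (\<tau> i)) \<omega>) *\<^sub>R \<xi> i \<omega> =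
      (W v \<omega> - W u \<omega>) *\<^sub>R indicat_real {\<tau> i<..\<tau> (Suc i)} v *\<^sub>R \<xi> i \<omega>"
  proof cases
    case 1
    then show ?thesis using i uv by (simp add: min_def)
  next
    case 2
    then show ?thesis using i uv by (simp add: min_def)
  next
    case 3
    then show ?thesis using uv by (simp add: min_def algebra_simps)
  qed
qed

lemma elementary_times_nonneg:
  assumes "elementary_data P F m \<tau> \<xi>" "i \<le> m"
  shows "0 \<le> \<tau> i"
  using assms(2) by (induction i) (use assms(1) in \<open>auto simp: elementary_data_def intro: order_trans\<close>)

lemma elementary_integral_0:
  assumes "elementary_data P F m \<tau> \<xi>"
  shows "elementary_integral W m \<tau> \<xi> 0 \<omega> = 0"
  using elementary_times_nonneg[OF assms] unfolding elementary_integral_def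
  by (intro sum.neutral) (auto simp: min_def)

lemma elementary_process_bounded:
  assumes "elementary_data P F m \<tau> \<xi>"
  obtains c where "\<And>r \<omega>. \<omega> \<in> space P \<Longrightarrow> norm (elementary_process m \<tau> \<xi> r \<omega>) \<le> c"
proof -
  have "\<exists>c. \<forall>\<omega>\<in>space P. norm (\<xi> i \<omega>) \<le> c" if "i < m" for i
    using assms that by (auto simp: elementary_data_def bounded_iff)
  then obtain c where c: "\<And>i \<omega>. i < m \<Longrightarrow> \<omega> \<in> space P \<Longrightarrow> norm (\<xi> i \<omega>) \<le> c i"
    by metis
  have "norm (elementary_process m \<tau> \<xi> r \<omega>) \<le> (\<Sum>i<m. c i)" if "\<omega> \<in> space P" for r \<omega>
    unfolding elementary_process_def
  proof (rule order_trans[OF norm_sum], rule sum_mono)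
    fix i assume "i \<in> {..<m}"
    then have "norm (\<xi> i \<omega>) \<le> c i" using c that by simp
    then show "norm (indicat_real {\<tau> i<..\<tau> (Suc i)} r *\<^sub>R \<xi> i \<omega>) \<le> c i"
      using order_trans[OF norm_ge_zero] by (auto simp: indicator_def)
  qed
  then show thesis using that by blast
qed

text \<open>Extension by 0 replaces the restricted time space by all of \<open>borel\<close>, so
  that integrals over time become measurable in \<omega> by Fubini. Nothing is known about the
  process at negative times.\<close>

lemma progressive_extension:
  fixes X :: "real \<Rightarrow> 'w \<Rightarrow> 'e::{real_normed_vector, second_countable_topology}"
  assumes X: "progressive_process F X" and t: "0 \<le> t"
  shows "(\<lambda>(s, \<omega>). if s \<in> {0..t} then X s \<omega> else 0) \<in> borel_measurable (borel \<Otimes>\<^sub>M F t)"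
proof -
  let ?A = "{0..t} \<times> space (F t)"
  have "(\<lambda>z. (fst z, snd z)) \<in> restrict_space (borel \<Otimes>\<^sub>M F t) ?A \<rightarrow>\<^sub>M restrict_space borel {0..t} \<Otimes>\<^sub>M F t"
  proof (rule measurable_Pair)
    show "fst \<in> restrict_space (borel \<Otimes>\<^sub>M F t) ?A \<rightarrow>\<^sub>M restrict_space borel {0..t}"
      by (rule measurable_restrict_space2)
        (auto simp: space_restrict_space intro: measurable_restrict_space1)
    show "snd \<in> restrict_space (borel \<Otimes>\<^sub>M F t) ?A \<rightarrow>\<^sub>M F t"
      by (intro measurable_restrict_space1) simp
  qed
  then have "(\<lambda>z. X (fst z) (snd z)) \<in> borel_measurable (restrict_space (borel \<Otimes>\<^sub>M F t) ?A)"
    using X t measurable_compose[of "\<lambda>z. (fst z, snd z)" _ _ "\<lambda>(s, \<omega>). X s \<omega>" borel]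
    by (auto simp: progressive_process_def)
  moreover have "?A \<in> sets (borel \<Otimes>\<^sub>M F t)" by simp
  ultimately have "(\<lambda>z. if z \<in> ?A then X (fst z) (snd z) else 0) \<in> borel_measurable (borel \<Otimes>\<^sub>M F t)"
    by (subst (asm) measurable_restrict_space_iff[where c=0]) (auto simp: space_pair_measure)
  then show ?thesis
    by (rule measurable_cong[THEN iffD1, rotated]) (auto simp: space_pair_measure split: if_splits)
qed

lemma progressive_adapted:
  fixes X :: "real \<Rightarrow> 'w \<Rightarrow> 'e::{real_normed_vector, second_countable_topology}"
  assumes "progressive_process F X" "0 \<le> t"
  shows "X t \<in> borel_measurable (F t)"
  using measurable_compose[OF measurable_Pair1' progressive_extension[OF assms], of t] assms(2) by simp

lemma progressive_path:
  fixes X :: "real \<Rightarrow> 'w \<Rightarrow> 'e::{real_normed_vector, second_countable_topology}"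
  assumes "progressive_process F X" "0 \<le> t" "\<omega> \<in> space (F t)"
  shows "(\<lambda>s. if s \<in> {0..t} then X s \<omega> else 0) \<in> borel_measurable borel"
  using measurable_compose[OF measurable_Pair2'[OF assms(3)] progressive_extension[OF assms(1,2)]] by simp

lemma progressive_LINT_measurable:
  fixes X :: "real \<Rightarrow> 'w \<Rightarrow> 'e::{banach, second_countable_topology}"
  assumes X: "progressive_process F X" and t: "0 \<le> a" "a \<le> t"
  shows "(\<lambda>\<omega>. LINT r:{a..t}|lborel. X r \<omega>) \<in> borel_measurable (F t)"
proof -
  let ?X = "\<lambda>s \<omega>. if s \<in> {0..t} then X s \<omega> else 0"
  have "(\<lambda>(s, \<omega>). ?X s \<omega>) \<in> borel_measurable (borel \<Otimes>\<^sub>M F t)"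
    using progressive_extension[OF X, of t] t by simp
  from measurable_pair_swap[OF this] have [measurable]: "(\<lambda>(\<omega>, s). ?X s \<omega>) \<in> borel_measurable (F t \<Otimes>\<^sub>M borel)"
    by (simp add: case_prod_unfold cong: if_cong)
  have "(\<lambda>\<omega>. LINT r:{a..t}|lborel. X r \<omega>) = (\<lambda>\<omega>. LINT r|lborel. indicat_real {a..t} r *\<^sub>R ?X r \<omega>)"
    unfolding set_lebesgue_integral_def using t
    by (intro ext Bochner_Integration.integral_cong) (auto simp: indicator_def)
  also have "\<dots> \<in> borel_measurable (F t)" by measurable
  finally show ?thesis .
qed

lemma progressive_nn_integral_measurable:
  fixes X :: "real \<Rightarrow> 'w \<Rightarrow> 'e::{real_normed_vector, second_countable_topology}"
  assumes X: "progressive_process F X" and t: "0 \<le> a" "a \<le> t"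
    and [measurable]: "\<eta> \<in> borel_measurable (F t)"
  shows "(\<lambda>\<omega>. \<integral>\<^sup>+r\<in>{a<..t}. ennreal ((norm (\<eta> \<omega> - X r \<omega>))\<^sup>2) \<partial>lborel) \<in> borel_measurable (F t)"
proof -
  let ?X = "\<lambda>s \<omega>. if s \<in> {0..t} then X s \<omega> else 0"
  have "(\<lambda>(s, \<omega>). ?X s \<omega>) \<in> borel_measurable (borel \<Otimes>\<^sub>M F t)"
    using progressive_extension[OF X, of t] t by simp
  from measurable_pair_swap[OF this] have [measurable]: "(\<lambda>(\<omega>, s). ?X s \<omega>) \<in> borel_measurable (F t \<Otimes>\<^sub>M borel)"
    by (simp add: case_prod_unfold cong: if_cong)
  have "(\<lambda>\<omega>. \<integral>\<^sup>+r\<in>{a<..t}. ennreal ((norm (\<eta> \<omega> - X r \<omega>))\<^sup>2) \<partial>lborel)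
      = (\<lambda>\<omega>. \<integral>\<^sup>+r\<in>{a<..t}. ennreal ((norm (\<eta> \<omega> - ?X r \<omega>))\<^sup>2) \<partial>lborel)"
    using t by (intro ext nn_integral_cong) (auto simp: indicator_def)
  also have "\<dots> \<in> borel_measurable (F t)" by measurable
  finally show ?thesis .
qed

lemma progressive_compose2:
  fixes X :: "real \<Rightarrow> 'w \<Rightarrow> 'a::{second_countable_topology}"
    and Y :: "real \<Rightarrow> 'w \<Rightarrow> 'b::{second_countable_topology}"
  assumes "progressive_process F X" "progressive_process F Y"
    and \<phi>: "(\<lambda>(x, y). \<phi> x y) \<in> borel_measurable borel"
  shows "progressive_process F (\<lambda>t \<omega>. \<phi> (X t \<omega>) (Y t \<omega>))"
  unfolding progressive_process_def
proof (intro allI impI)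
  fix t :: real assume "0 \<le> t"
  then have "(\<lambda>(s, \<omega>). X s \<omega>) \<in> borel_measurable (restrict_space borel {0..t} \<Otimes>\<^sub>M F t)"
    "(\<lambda>(s, \<omega>). Y s \<omega>) \<in> borel_measurable (restrict_space borel {0..t} \<Otimes>\<^sub>M F t)"
    using assms(1,2) by (auto simp: progressive_process_def)
  from measurable_compose[OF borel_measurable_Pair[OF this] \<phi>]
  show "(\<lambda>(s, \<omega>). \<phi> (X s \<omega>) (Y s \<omega>)) \<in> borel_measurable (restrict_space borel {0..t} \<Otimes>\<^sub>M F t)"
    by (simp add: case_prod_unfold)
qed

text \<open>Predictability on the grid: an interval that contributes at \<open>v\<close> starts
  before \<open>v\<close>, hence not after \<open>u\<close>, so its coefficient is already known at
  \<open>u\<close>.\<close>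

lemma (in brownian_filtration) elementary_process_cell_measurable:
  fixes \<xi> :: "nat \<Rightarrow> 'w \<Rightarrow> 'e::{real_normed_vector, second_countable_topology}"
  assumes el: "elementary_data P F m \<tau> \<xi>"
    and no: "\<And>i. i \<le> m \<Longrightarrow> \<not> (u < \<tau> i \<and> \<tau> i < v)"
  shows "elementary_process m \<tau> \<xi> v \<in> borel_measurable (F u)"
  unfolding elementary_process_def
proof (intro borel_measurable_sum)
  fix i assume "i \<in> {..<m}"
  then have i: "i < m" by simp
  show "(\<lambda>\<omega>. indicat_real {\<tau> i<..\<tau> (Suc i)} v *\<^sub>R \<xi> i \<omega>) \<in> borel_measurable (F u)"
  proof (cases "\<tau> i < v")
    case True
    then have "\<tau> i \<le> u" using no[of i] i by auto
    moreover have "\<xi> i \<in> borel_measurable (F (\<tau> i))" using el i by (auto simp: elementary_data_def)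
    ultimately have "\<xi> i \<in> borel_measurable (F u)"
      using measurable_F_mono elementary_times_nonneg[OF el, of i] i by auto
    then show ?thesis by simp
  qed simp
qed

section \<open>Comparison of two solutions\<close>

lemma pred_countable_Ball:
  assumes "countable X" "\<And>i. i \<in> X \<Longrightarrow> Measurable.pred M (\<lambda>x. Q i x)"
  shows "Measurable.pred M (\<lambda>x. \<forall>i\<in>X. Q i x)"
  using assms by (auto simp: pred_def intro!: sets.sets_Collect_countable_Ball)

lemma sum_cells_le:
  fixes f :: "real \<Rightarrow> ennreal"
  assumes u: "\<And>i. i < n \<Longrightarrow> u i < u (Suc i)" "u 0 = 0" "u n = T"
    and meas: "\<And>i. i < n \<Longrightarrow> (\<lambda>r. g i r * indicator {u i<..u (Suc i)} r) \<in> borel_measurable lborel"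
    and eq: "\<And>i r. i < n \<Longrightarrow> r \<in> {u i<..u (Suc i)} \<Longrightarrow> g i r = f r"
  shows "(\<Sum>i<n. \<integral>\<^sup>+r\<in>{u i<..u (Suc i)}. g i r \<partial>lborel) \<le> (\<integral>\<^sup>+r\<in>{0..T}. f r \<partial>lborel)"
proof -
  have mono: "0 \<le> u l" if "l \<le> n" for l
    using that
  proof (induction l)
    case (Suc l)
    then show ?case using u(1)[of l] by simp
  qed (use u in simp)
  have "(\<Sum>i<l. g i r * indicator {u i<..u (Suc i)} r) = f r * indicator {0<..u l} r" if "l \<le> n" for l r
    using that
  proof (induction l)
    case 0
    then show ?case using u by simp
  next
    case (Suc l)
    then have l: "l < n" by simp
    have "(\<Sum>i<Suc l. g i r * indicator {u i<..u (Suc i)} r)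
        = f r * indicator {0<..u l} r + g l r * indicator {u l<..u (Suc l)} r"
      using Suc by simp
    also have "\<dots> = f r * indicator {0<..u (Suc l)} r"
      using u(1)[OF l] eq[OF l, of r] mono[of l] l by (auto simp: indicator_def)
    finally show ?case .
  qed
  note sum_eq = this
  have "(\<Sum>i<n. \<integral>\<^sup>+r\<in>{u i<..u (Suc i)}. g i r \<partial>lborel)
      = (\<integral>\<^sup>+r. (\<Sum>i<n. g i r * indicator {u i<..u (Suc i)} r) \<partial>lborel)"
    using meas by (intro nn_integral_sum[symmetric]) auto
  also have "\<dots> \<le> (\<integral>\<^sup>+r\<in>{0..T}. f r \<partial>lborel)"
    unfolding sum_eq[OF order_refl] u(3) by (intro nn_integral_mono) (auto simp: indicator_def)
  finally show ?thesis .
qed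

text \<open>Neighbouring closed cells share only a grid point, which is a null set, so the
  almost-everywhere form of additivity applies.\<close>

lemma LINT_cells:
  fixes V :: "real \<Rightarrow> 'e::{banach, second_countable_topology}"
  assumes V: "set_integrable lborel {0..T} V"
    and u: "\<And>i. i < n \<Longrightarrow> u i < u (Suc i)" "u 0 = 0" "u n = T" and l: "l \<le> n"
  shows "(\<Sum>i<l. LINT r:{u i..u (Suc i)}|lborel. V r) = (LINT r:{0..u l}|lborel. V r)"
proof -
  have mono: "0 \<le> u i \<and> u i \<le> u l" if "l \<le> n" "i \<le> l" for l i
  proof -
    have "u i \<le> u l" if "i \<le> l" "l \<le> n" for i l
      using that
    proof (induction l rule: dec_induct)
      case (step k)
      then show ?case using u(1)[of k] by simp
    qed simp
    from this[of i l] this[of 0 i] show ?thesis using that u by auto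
  qed
  show "(\<Sum>i<l. LINT r:{u i..u (Suc i)}|lborel. V r) = (LINT r:{0..u l}|lborel. V r)"
    using l
  proof (induction l)
    case 0
    have "AE r in lborel. indicat_real {0..0} r *\<^sub>R V r = 0"
      using AE_lborel_singleton[of "0::real"] by eventually_elim (auto simp: indicator_def)
    then have "(LINT r:{0..u 0}|lborel. V r) = 0"
      unfolding set_lebesgue_integral_def u(2) by (rule integral_eq_zero_AE)
    then show ?case by simp
  next
    case (Suc l)
    have sub: "set_integrable lborel {0..u l} V" "set_integrable lborel {u l..u (Suc l)} V"
      using mono[of n l] mono[of n "Suc l"] Suc.prems u(3) by (auto intro!: set_integrable_subset[OF V])
    have "{0..u l} \<union> {u l..u (Suc l)} = {0..u (Suc l)}"
      using mono[of n l] u(1)[of l] Suc.prems by auto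
    moreover have "AE r in lborel. \<not> (r \<in> {0..u l} \<and> r \<in> {u l..u (Suc l)})"
      using AE_lborel_singleton[of "u l"] by (auto elim!: eventually_mono)
    ultimately show ?case
      using set_integral_Un_AE[OF _ _ _ sub] Suc by simp
  qed
qed

text \<open>The problem localised to the ball of radius \<open>N\<close>: \<kappa>1 and \<kappa>2
  stand for the values of \<open>k\<close> and \<open>h\<close> at \<open>N\<close>, and
  \<open>S\<close> for the difference of the two diffusion integrands, of which only its bound in
  the ball and its progressive measurability are recorded.\<close>

locale sde_pair = brownian_filtration P F W
  for P :: "'w measure" and F :: "real \<Rightarrow> 'w measure" and W :: "real \<Rightarrow> 'w \<Rightarrow> real" +
  fixes j0 :: "'a::{real_normed_vector, second_countable_topology} \<Rightarrow>
               'b::{real_inner, banach, second_countable_topology}"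
    and b :: "'a \<Rightarrow> 'b" and S :: "real \<Rightarrow> 'w \<Rightarrow> 'b" and X1 X2 :: "real \<Rightarrow> 'w \<Rightarrow> 'a"
    and N Cb \<kappa>1 \<kappa>2 T :: real
  assumes j0: "bounded_linear j0"
    and b: "b \<in> borel_measurable borel" "\<And>x. norm x \<le> N \<Longrightarrow> norm (b x) \<le> Cb"
    and one_sided: "\<And>x y. norm x \<le> N \<Longrightarrow> norm y \<le> N \<Longrightarrow>
      inner (b x - b y) (j0 (x - y)) \<le> \<kappa>1 * (norm (j0 (x - y)))\<^sup>2"
    and prog: "progressive_process F X1" "progressive_process F X2" "progressive_process F S"
    and S_bound: "\<And>t \<omega>. norm (X1 t \<omega>) \<le> N \<Longrightarrow> norm (X2 t \<omega>) \<le> N \<Longrightarrow>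
      norm (S t \<omega>) \<le> \<kappa>2 * norm (j0 (X1 t \<omega> - X2 t \<omega>))"
    and cont: "ae_continuous_paths P X1" "ae_continuous_paths P X2"
    and pos: "0 \<le> N" "0 \<le> Cb" "0 \<le> \<kappa>1" "0 \<le> \<kappa>2" "0 < T"
begin

definition Y :: "real \<Rightarrow> 'w \<Rightarrow> 'b" where "Y t \<omega> = j0 (X1 t \<omega> - X2 t \<omega>)"

text \<open>The cutoff makes the drift difference bounded for all times and all \<omega>, so its
  cell integrals are bounded random variables; nothing changes on paths that stay in the
  ball.\<close>

definition V :: "real \<Rightarrow> 'w \<Rightarrow> 'b" where
  "V t \<omega> = (if norm (X1 t \<omega>) \<le> N \<and> norm (X2 t \<omega>) \<le> N then b (X1 t \<omega>) - b (X2 t \<omega>) else 0)"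

definition J :: real where "J = onorm j0"

text \<open>K0 bounds the accumulated error of the discrete energy inequality by a multiple of \<epsilon>,
  uniformly in the elementary approximation; it collects the constants of pathwise_energy_bound.\<close>

definition K0 :: real where
  "K0 = (16 * \<kappa>1 + 8 * Cb + 8 * Cb\<^sup>2 + 32 * \<kappa>2\<^sup>2) * T + 6 + 4 * (2 * J * N + 1) * Cb"

text \<open>The coefficient of the squared norm of \<open>Z i\<close> in
  \<open>pathwise_energy_bound\<close>, hence the rate in Gronwall's inequality.\<close>

definition rate :: real where "rate = 4 * \<kappa>1 + 8 * \<kappa>2\<^sup>2"

lemma J_nonneg: "0 \<le> J" by (simp add: J_def onorm_pos_le[OF j0])

lemma norm_Y: "norm (X1 t \<omega>) \<le> N \<Longrightarrow> norm (X2 t \<omega>) \<le> N \<Longrightarrow> norm (Y t \<omega>) \<le> 2 * J * N"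
proof -
  assume *: "norm (X1 t \<omega>) \<le> N" "norm (X2 t \<omega>) \<le> N"
  have "norm (Y t \<omega>) \<le> J * norm (X1 t \<omega> - X2 t \<omega>)"
    unfolding Y_def J_def by (rule onorm[OF j0])
  also have "\<dots> \<le> J * (2 * N)"
    using * norm_triangle_ineq4[of "X1 t \<omega>" "X2 t \<omega>"] J_nonneg by (intro mult_left_mono) auto
  finally show ?thesis by simp
qed

lemma norm_V: "norm (V t \<omega>) \<le> 2 * Cb"
  using b(2)[of "X1 t \<omega>"] b(2)[of "X2 t \<omega>"] norm_triangle_ineq4[of "b (X1 t \<omega>)" "b (X2 t \<omega>)"] pos
  by (auto simp: V_def)

lemma progressive_V: "progressive_process F V"
proof -
  note [measurable] = b(1)
  have "(\<lambda>(x, y). if norm x \<le> N \<and> norm y \<le> N then b x - b y else 0) \<in> borel_measurable (borel \<Otimes>\<^sub>M borel)"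
    by measurable
  then show ?thesis
    unfolding V_def by (intro progressive_compose2[OF prog(1,2)]) (simp add: borel_prod)
qed

lemma adapted_Y: "0 \<le> t \<Longrightarrow> Y t \<in> borel_measurable (F t)"
proof -
  assume "0 \<le> t"
  note [measurable] = progressive_adapted[OF prog(1) this] progressive_adapted[OF prog(2) this]
    borel_measurable_continuous_onI[OF linear_continuous_on[OF j0]]
  show ?thesis unfolding Y_def by measurable
qed

lemma continuous_Y:
  "AE \<omega> in P. continuous_on {0..} (\<lambda>t. X1 t \<omega>) \<and> continuous_on {0..} (\<lambda>t. X2 t \<omega>)
     \<and> continuous_on {0..} (\<lambda>t. Y t \<omega>)"
  using cont unfolding ae_continuous_paths_def Y_def
  by eventually_elim (auto intro!: bounded_linear.continuous_on[OF j0] continuous_intros)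

lemma path_measurable:
  fixes Z :: "real \<Rightarrow> 'w \<Rightarrow> 'e::{real_normed_vector, second_countable_topology}"
  assumes "progressive_process F Z" "\<omega> \<in> space P"
  shows "(\<lambda>s. if s \<in> {0..T} then Z s \<omega> else 0) \<in> borel_measurable borel"
  by (rule progressive_path[OF assms(1)]) (use assms pos space_F in auto)


lemma stopped_estimate:
  fixes \<xi>1 \<xi>2 :: "nat \<Rightarrow> 'w \<Rightarrow> 'b"
  assumes el: "elementary_data P F m1 \<tau>1 \<xi>1" "elementary_data P F m2 \<tau>2 \<xi>2"
    and \<epsilon>: "0 < \<epsilon>" "\<epsilon> \<le> 1" and \<delta>0: "0 < \<delta>0"
  defines "H \<equiv> \<lambda>r \<omega>. elementary_process m1 \<tau>1 \<xi>1 r \<omega> - elementary_process m2 \<tau>2 \<xi>2 r \<omega>"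
    and "I \<equiv> \<lambda>t \<omega>. elementary_integral W m1 \<tau>1 \<xi>1 t \<omega> - elementary_integral W m2 \<tau>2 \<xi>2 t \<omega>"
  obtains Z :: "'w \<Rightarrow> 'b" where "Z \<in> borel_measurable P" "integrable P (\<lambda>\<omega>. (norm (Z \<omega>))\<^sup>2)"
    "expectation (\<lambda>\<omega>. (norm (Z \<omega>))\<^sup>2) \<le> \<epsilon> * (K0 * exp (rate * T))"
    "\<And>\<omega>. \<lbrakk>\<omega> \<in> space P;
        \<And>s. s \<in> {0..T} \<Longrightarrow> norm (X1 s \<omega>) \<le> N \<and> norm (X2 s \<omega>) \<le> N;
        \<And>s s'. s \<in> {0..T} \<Longrightarrow> s' \<in> {0..T} \<Longrightarrow> \<bar>s - s'\<bar> \<le> \<delta>0 \<Longrightarrow> norm (Y s \<omega> - Y s' \<omega>) \<le> \<epsilon>;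
        (\<integral>\<^sup>+r\<in>{0..T}. ennreal ((norm (H r \<omega> - S r \<omega>))\<^sup>2) \<partial>lborel) \<le> ennreal \<epsilon>;
        \<And>t. t \<in> {0..T} \<Longrightarrow> norm (Y t \<omega> - ((LINT r:{0..t}|lborel. V r \<omega>) + I t \<omega>)) \<le> \<epsilon>\<rbrakk>
      \<Longrightarrow> norm (Y T \<omega> - Z \<omega>) \<le> \<epsilon>"
proof -
  obtain c1 where c1: "\<And>r \<omega>. \<omega> \<in> space P \<Longrightarrow> norm (elementary_process m1 \<tau>1 \<xi>1 r \<omega>) \<le> c1"
    using elementary_process_bounded[OF el(1)] by blast
  obtain c2 where c2: "\<And>r \<omega>. \<omega> \<in> space P \<Longrightarrow> norm (elementary_process m2 \<tau>2 \<xi>2 r \<omega>) \<le> c2"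
    using elementary_process_bounded[OF el(2)] by blast
  define c where "c = c1 + c2"
  have H_le: "norm (H r \<omega>) \<le> c" if "\<omega> \<in> space P" for r \<omega>
    unfolding H_def c_def using c1[OF that, of r] c2[OF that, of r]
      norm_triangle_ineq4[of "elementary_process m1 \<tau>1 \<xi>1 r \<omega>" "elementary_process m2 \<tau>2 \<xi>2 r \<omega>"]
    by linarith
  \<comment> \<open>In the cell where the scheme is frozen, the increments are only controlled by the crude bound c.
    The mesh absorbs it: there is one such cell, and c^2 * \<delta> \<le> \<epsilon>.\<close>
  define \<delta> where "\<delta> = min \<epsilon> (min \<delta>0 (\<epsilon> / (1 + c\<^sup>2)))"
  have c_pos: "0 < 1 + c\<^sup>2" by (simp add: add_pos_nonneg)
  then have \<delta>: "0 < \<delta>" "\<delta> \<le> \<epsilon>" "\<delta> \<le> \<delta>0" using \<epsilon> \<delta>0 by (auto simp: \<delta>_def)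
  have "\<delta> * (1 + c\<^sup>2) \<le> \<epsilon>"
    using c_pos pos_le_divide_eq[OF c_pos, of \<delta> \<epsilon>] by (auto simp: \<delta>_def)
  then have \<delta>c: "c\<^sup>2 * \<delta> \<le> \<epsilon>" using \<delta> by (simp add: algebra_simps)
  obtain u n where u: "u 0 = 0" "u n = T" "\<And>l. l < n \<Longrightarrow> u l < u (Suc l)"
      "\<And>l. l < n \<Longrightarrow> u (Suc l) - u l \<le> \<delta>"
    and no: "\<And>l q. l < n \<Longrightarrow> q \<in> \<tau>1 ` {..m1} \<union> \<tau>2 ` {..m2} \<Longrightarrow> \<not> (u l < q \<and> q < u (Suc l))"
    using grid_exists[of "\<tau>1 ` {..m1} \<union> \<tau>2 ` {..m2}" T \<delta>] pos \<delta> by blast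
  have no1: "\<not> (u l < \<tau>1 i \<and> \<tau>1 i < u (Suc l))" if "l < n" "i \<le> m1" for l i
    using no[OF that(1), of "\<tau>1 i"] that(2) by auto
  have no2: "\<not> (u l < \<tau>2 i \<and> \<tau>2 i < u (Suc l))" if "l < n" "i \<le> m2" for l i
    using no[OF that(1), of "\<tau>2 i"] that(2) by auto
  have umono: "u i \<le> u l" if "i \<le> l" "l \<le> n" for i l
    using that
  proof (induction l rule: dec_induct)
    case (step k)
    then show ?case using u(3)[of k] by simp
  qed simp
  have u_in: "u l \<in> {0..T}" if "l \<le> n" for l
    using umono[of 0 l] umono[of l n] that u by auto
  have u0: "0 \<le> u l" if "l \<le> n" for l using u_in[OF that] by simp

  \<comment> \<open>The value at the right end is the value on the whole cell, and it is known at
    the left end because no jump time lies inside.\<close>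
  define \<eta> where "\<eta> l = H (u (Suc l))" for l
  define \<beta> where "\<beta> l \<omega> = (LINT r:{u l..u (Suc l)}|lborel. V r \<omega>)" for l \<omega>
  define B where "B l \<omega> = \<beta> l \<omega> + (W (u (Suc l)) \<omega> - W (u l) \<omega>) *\<^sub>R \<eta> l \<omega>" for l \<omega>
  define Q where "Q l \<omega> = (\<integral>\<^sup>+r\<in>{u l<..u (Suc l)}. ennreal ((norm (\<eta> l \<omega> - S r \<omega>))\<^sup>2) \<partial>lborel)" for l \<omega>
  define G1 where "G1 i \<omega> \<longleftrightarrow> norm (X1 (u i) \<omega>) \<le> N \<and> norm (X2 (u i) \<omega>) \<le> N
    \<and> norm (Y (u i) \<omega> - (\<Sum>j<i. B j \<omega>)) \<le> \<epsilon>" for i \<omega>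
  define G2 where "G2 i s \<omega> \<longleftrightarrow> norm (X1 s \<omega>) \<le> N \<and> norm (X2 s \<omega>) \<le> N
    \<and> norm (Y s \<omega> - Y (u i) \<omega>) \<le> \<epsilon>" for i s \<omega>
  define G where "G l \<omega> \<longleftrightarrow> (\<forall>i\<in>{..l}. G1 i \<omega>) \<and> (\<forall>i\<in>{..<l}. \<forall>s\<in>\<rat> \<inter> {u i..u (Suc i)}. G2 i s \<omega>)
    \<and> (\<Sum>i<l. Q i \<omega>) \<le> ennreal \<epsilon>" for l \<omega>
  \<comment> \<open>D l is the event that the scheme is still running at the grid time u l. It must be
    F (u l)-measurable, hence the restriction to rational times. On D l the frozen sum Z l agrees
    with the unfrozen one, see Z_eq.\<close>
  define D where "D l = {\<omega> \<in> space P. G l \<omega>}" for l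
  define Z where "Z l \<omega> = (\<Sum>i<l. indicat_real (D i) \<omega> *\<^sub>R
      (\<beta> i \<omega> + (W (u (Suc i)) \<omega> - W (u i) \<omega>) *\<^sub>R \<eta> i \<omega>))" for l \<omega>

  have \<eta>_meas: "\<eta> l \<in> borel_measurable (F (u l))" if l: "l < n" for l
    unfolding \<eta>_def H_def
    using elementary_process_cell_measurable[OF el(1), of "u l" "u (Suc l)"]
      elementary_process_cell_measurable[OF el(2), of "u l" "u (Suc l)"] no1[OF l] no2[OF l]
    by (intro borel_measurable_diff) auto
  have \<beta>_meas: "\<beta> l \<in> borel_measurable (F (u (Suc l)))" if l: "l < n" for l
    unfolding \<beta>_def using progressive_LINT_measurable[OF progressive_V, of "u l" "u (Suc l)"] u0[of l] u(3)[OF l] l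
    by simp
  have B_meas: "B j \<in> borel_measurable (F (u i))" if "j < i" "i \<le> n" for i j
  proof -
    have j: "j < n" "u (Suc j) \<le> u i" using that umono[of "Suc j" i] by auto
    have uj: "0 \<le> u j" "u j \<le> u (Suc j)" using u0[of j] u(3)[OF j(1)] j by auto
    note [measurable] = \<beta>_meas[OF j(1)] measurable_F_mono[OF \<eta>_meas[OF j(1)] uj]
      increment_measurable[OF uj]
    have "B j \<in> borel_measurable (F (u (Suc j)))"
      unfolding B_def by (intro borel_measurable_add borel_measurable_scaleR) measurable
    then show ?thesis using measurable_F_mono[OF _ u0 j(2)] j by auto
  qed
  have Q_meas: "Q i \<in> borel_measurable (F (u l))" if "i < l" "l \<le> n" for i l
  proof -
    have i: "i < n" "u (Suc i) \<le> u l" using that umono[of "Suc i" l] by auto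
    have "\<eta> i \<in> borel_measurable (F (u (Suc i)))"
      using measurable_F_mono[OF \<eta>_meas[OF i(1)], of "u (Suc i)"] u0[of i] u(3)[OF i(1)] i by simp
    then have "Q i \<in> borel_measurable (F (u (Suc i)))"
      unfolding Q_def using u0[of i] u(3)[OF i(1)] i
      by (intro progressive_nn_integral_measurable[OF prog(3)]) auto
    then show ?thesis using measurable_F_mono[OF _ u0 i(2)] i by auto
  qed
  have X_meas: "X1 s \<in> borel_measurable (F t)" "X2 s \<in> borel_measurable (F t)" "Y s \<in> borel_measurable (F t)"
    if "0 \<le> s" "s \<le> t" for s t
    using progressive_adapted[OF prog(1), of s] progressive_adapted[OF prog(2), of s] adapted_Y[of s]
      measurable_F_mono that by auto
  have D_sets: "D l \<in> sets (F (u l))" if l: "l \<le> n" for l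
  proof -
    have "Measurable.pred (F (u l)) (G1 i)" if "i \<in> {..l}" for i
    proof -
      have i: "0 \<le> u i" "u i \<le> u l" using that l u0 umono by auto
      note [measurable] = X_meas[OF i]
      have [measurable]: "(\<lambda>\<omega>. \<Sum>j<i. B j \<omega>) \<in> borel_measurable (F (u l))"
        using that l by (intro borel_measurable_sum measurable_F_mono[OF B_meas _ i(2)] i) auto
      show ?thesis unfolding G1_def by measurable
    qed
    moreover have "Measurable.pred (F (u l)) (G2 i s)" if "i \<in> {..<l}" "s \<in> \<rat> \<inter> {u i..u (Suc i)}" for i s
    proof -
      have i: "0 \<le> u i" "u i \<le> u l" "u (Suc i) \<le> u l" using that l u0 umono by auto
      have s: "0 \<le> s" "s \<le> u l" using that i by auto
      note [measurable] = X_meas[OF i(1,2)] X_meas[OF s]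
      show ?thesis unfolding G2_def by measurable
    qed
    moreover have "Measurable.pred (F (u l)) (\<lambda>\<omega>. (\<Sum>i<l. Q i \<omega>) \<le> ennreal \<epsilon>)"
    proof -
      have [measurable]: "(\<lambda>\<omega>. \<Sum>i<l. Q i \<omega>) \<in> borel_measurable (F (u l))"
        using l by (intro borel_measurable_sum Q_meas) auto
      show ?thesis by measurable
    qed
    ultimately have "Measurable.pred (F (u l)) (G l)"
      unfolding G_def
      by (intro pred_intros_logic pred_intros_finite pred_countable_Ball countable_Int1 countable_rat) auto
    then show ?thesis
      using space_F[OF u0[OF l]] by (simp add: D_def pred_def)
  qed
  have D_mono: "\<omega> \<in> D i" if "\<omega> \<in> D l" "i \<le> l" for \<omega> i l
  proof -
    have "(\<Sum>i<i. Q i \<omega>) \<le> (\<Sum>i<l. Q i \<omega>)" using that by (intro sum_mono2) auto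
    then show ?thesis using that unfolding D_def G_def by (auto intro: order_trans)
  qed
  have Z_eq: "Z l \<omega> = (\<Sum>j<l. B j \<omega>)" if "\<omega> \<in> D l" for l \<omega>
    unfolding Z_def B_def using D_mono[OF that] by (intro sum.cong) auto
  have near0: "norm (Y (u l) \<omega> - Z l \<omega>) \<le> \<epsilon>" if "\<omega> \<in> D l" for l \<omega>
    using that Z_eq[OF that] by (auto simp: D_def G_def G1_def)

  \<comment> \<open>\<open>G2\<close> tests only rational times of the cell; continuity extends the
    bounds to all of them. Membership in \<open>D (Suc l)\<close> is assumed because
    \<open>D l\<close> does not look into the cell that starts at \<open>u l\<close>.\<close>
  have cell: "norm (X1 r \<omega>) \<le> N \<and> norm (X2 r \<omega>) \<le> N \<and> norm (Y r \<omega> - Y (u l) \<omega>) \<le> \<epsilon>"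
    if \<omega>: "continuous_on {0..} (\<lambda>t. X1 t \<omega>) \<and> continuous_on {0..} (\<lambda>t. X2 t \<omega>) \<and> continuous_on {0..} (\<lambda>t. Y t \<omega>)"
      and l: "l < n" "\<omega> \<in> D (Suc l)" and r: "r \<in> {u l..u (Suc l)}" for \<omega> l r
  proof -
    have sub: "{u l..u (Suc l)} \<subseteq> {0..}" using u0[of l] l by auto
    have rat: "G2 l s \<omega>" if "s \<in> \<rat>" "s \<in> {u l..u (Suc l)}" for s
      using l(2) that by (auto simp: D_def G_def)
    have "norm (X1 r \<omega>) \<le> N"
      by (rule continuous_le_on_rationals[OF _ u(3)[OF l(1)] _ r])
        (use \<omega> sub rat in \<open>auto intro!: continuous_intros intro: continuous_on_subset simp: G2_def\<close>)
    moreover have "norm (X2 r \<omega>) \<le> N"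
      by (rule continuous_le_on_rationals[OF _ u(3)[OF l(1)] _ r])
        (use \<omega> sub rat in \<open>auto intro!: continuous_intros intro: continuous_on_subset simp: G2_def\<close>)
    moreover have "norm (Y r \<omega> - Y (u l) \<omega>) \<le> \<epsilon>"
      by (rule continuous_le_on_rationals[OF _ u(3)[OF l(1)] _ r])
        (use \<omega> sub rat in \<open>auto intro!: continuous_intros intro: continuous_on_subset simp: G2_def\<close>)
    ultimately show ?thesis by blast
  qed

  \<comment> \<open>The error constant of \<open>pathwise_energy_bound\<close>, with 2 * Cb bounding
    \<open>V\<close> and 2 * J * N + 1 bounding the running scheme: \<open>Y\<close> is at most 2 *
    J * N in the ball, and the scheme is within \<epsilon> \<le> 1 of it.\<close>
  define \<kappa> where "\<kappa> = (16 * \<kappa>1 * \<epsilon>\<^sup>2 + 4 * \<epsilon> * (2 * Cb) + 2 * (2 * Cb)\<^sup>2 * \<delta> + 32 * \<kappa>2\<^sup>2 * \<epsilon>\<^sup>2) * T + 4 * \<epsilon>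
         + (2 * (2 * J * N + 1) * (2 * Cb) + 2 * c\<^sup>2) * \<delta>"
  have \<kappa>_le: "\<kappa> \<le> \<epsilon> * K0"
  proof -
    \<comment> \<open>Together with \<delta> \<le> \<epsilon> and c^2 * \<delta> \<le> \<epsilon>
      this makes every term linear in \<epsilon>. The 6 in \<open>K0\<close> is 4 from the
      approximation error plus 2 from the exit cell.\<close>
    have e2: "\<epsilon>\<^sup>2 \<le> \<epsilon>" using \<epsilon> by (simp add: power2_eq_square mult_left_le)
    have "16 * \<kappa>1 * \<epsilon>\<^sup>2 + 4 * \<epsilon> * (2 * Cb) + 2 * (2 * Cb)\<^sup>2 * \<delta> + 32 * \<kappa>2\<^sup>2 * \<epsilon>\<^sup>2
      \<le> 16 * \<kappa>1 * \<epsilon> + 4 * \<epsilon> * (2 * Cb) + 2 * (2 * Cb)\<^sup>2 * \<epsilon> + 32 * \<kappa>2\<^sup>2 * \<epsilon>"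
      using e2 \<delta> pos by (intro add_mono mult_left_mono) auto
    then have "(16 * \<kappa>1 * \<epsilon>\<^sup>2 + 4 * \<epsilon> * (2 * Cb) + 2 * (2 * Cb)\<^sup>2 * \<delta> + 32 * \<kappa>2\<^sup>2 * \<epsilon>\<^sup>2) * T
      \<le> (16 * \<kappa>1 * \<epsilon> + 4 * \<epsilon> * (2 * Cb) + 2 * (2 * Cb)\<^sup>2 * \<epsilon> + 32 * \<kappa>2\<^sup>2 * \<epsilon>) * T"
      using pos by (intro mult_right_mono) auto
    moreover have "2 * (2 * J * N + 1) * (2 * Cb) * \<delta> \<le> 2 * (2 * J * N + 1) * (2 * Cb) * \<epsilon>"
      using \<delta> pos J_nonneg by (intro mult_left_mono) auto
    ultimately show ?thesis using \<delta>c
      unfolding \<kappa>_def K0_def by (simp add: algebra_simps)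
  qed
  have \<kappa>_nonneg: "0 \<le> \<kappa>"
    unfolding \<kappa>_def using pos \<epsilon> \<delta> J_nonneg by (intro add_nonneg_nonneg mult_nonneg_nonneg) auto

  have bound: "AE \<omega> in P. (\<Sum>i<l. indicat_real (D i) \<omega> * (2 * inner (Z i \<omega>) (\<beta> i \<omega>)
        + 2 * (norm (\<beta> i \<omega>))\<^sup>2 + 2 * (u (Suc i) - u i) * (norm (\<eta> i \<omega>))\<^sup>2))
      \<le> (\<Sum>i<l. rate * ((u (Suc i) - u i) * (norm (Z i \<omega>))\<^sup>2)) + \<kappa>" if l: "l \<le> n" for l
    using continuous_Y AE_space
  proof eventually_elim
    case (elim \<omega>)
    \<comment> \<open>Progressive measurability says nothing about negative times; the cutoff to
      \<open>{0..T}\<close> gives Borel functions on the whole line and changes no integral over a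
      cell.\<close>
    let ?V = "\<lambda>s. if s \<in> {0..T} then V s \<omega> else 0" and ?S = "\<lambda>s. if s \<in> {0..T} then S s \<omega> else 0"
    have in_T: "r \<in> {0..T}" if "i < n" "r \<in> {u i..u (Suc i)}" for i r
      using that u_in[of i] u_in[of "Suc i"] by auto
    have "(\<Sum>i<l. if \<omega> \<in> D i then 2 * inner (Z i \<omega>) (\<beta> i \<omega>) + 2 * (norm (\<beta> i \<omega>))\<^sup>2
            + 2 * (u (Suc i) - u i) * (norm (\<eta> i \<omega>))\<^sup>2 else 0)
       \<le> (\<Sum>i<l. (4 * \<kappa>1 + 8 * \<kappa>2\<^sup>2) * ((u (Suc i) - u i) * (norm (Z i \<omega>))\<^sup>2)) + \<kappa>"
      unfolding \<kappa>_def
    proof (rule pathwise_energy_bound[where n=n and V="?V" and S="?S" and Y="\<lambda>r. Y r \<omega>"])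
      show "\<beta> i \<omega> = (LINT r:{u i..u (Suc i)}|lborel. ?V r)" if "i < n" for i
        unfolding \<beta>_def using in_T[OF that] by (intro set_lebesgue_integral_cong) auto
      show "norm (\<eta> i \<omega>) \<le> c" for i
        unfolding \<eta>_def by (rule H_le) (use elim in auto)
      show "norm (Z i \<omega>) \<le> 2 * J * N + 1" if "i < n" "\<omega> \<in> D i" for i
      proof -
        have "norm (Y (u i) \<omega>) \<le> 2 * J * N"
          using that(2) by (intro norm_Y) (auto simp: D_def G_def G1_def)
        then show ?thesis
          using near0[OF that(2)] norm_triangle_ineq2[of "Z i \<omega>" "Y (u i) \<omega>"] \<epsilon>
          by (simp add: norm_minus_commute)
      qed
      fix i r assume i: "i < n" "\<omega> \<in> D (Suc i)" and r: "r \<in> {u i..u (Suc i)}"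
      note cell' = cell[OF elim(1) i r]
      show "norm (Y r \<omega> - Z i \<omega>) \<le> 2 * \<epsilon>"
        using cell' near0[OF D_mono[OF i(2)], of i] norm_triangle_ineq[of "Y r \<omega> - Y (u i) \<omega>" "Y (u i) \<omega> - Z i \<omega>"]
        by simp
      show "inner (?V r) (Y r \<omega>) \<le> \<kappa>1 * (norm (Y r \<omega>))\<^sup>2"
        using cell' in_T[OF i(1) r] one_sided[of "X1 r \<omega>" "X2 r \<omega>"] by (simp add: V_def Y_def)
      show "norm (?S r) \<le> \<kappa>2 * norm (Y r \<omega>)"
        using cell' in_T[OF i(1) r] S_bound[of r \<omega>] by (simp add: Y_def)
    next
      fix l assume l: "l \<le> n" "\<omega> \<in> D l"
      have "(\<integral>\<^sup>+r\<in>{u i<..u (Suc i)}. ennreal ((norm (\<eta> i \<omega> - ?S r))\<^sup>2) \<partial>lborel) = Q i \<omega>" if "i < l" for i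
        unfolding Q_def using in_T[of i] that l
        by (intro nn_integral_cong) (auto simp: indicator_def)
      then show "(\<Sum>i<l. \<integral>\<^sup>+r\<in>{u i<..u (Suc i)}. ennreal ((norm (\<eta> i \<omega> - ?S r))\<^sup>2) \<partial>lborel) \<le> ennreal \<epsilon>"
        using l(2) by (simp add: D_def G_def)
    next
      show "norm (?V r) \<le> 2 * Cb" for r using norm_V[of r \<omega>] pos by auto
    qed (use u path_measurable[OF progressive_V] path_measurable[OF prog(3)] elim D_mono pos \<epsilon> \<delta> J_nonneg l in auto)
    moreover have "indicat_real (D i) \<omega> * x = (if \<omega> \<in> D i then x else 0)" for i x by simp
    ultimately show ?case unfolding rate_def by (simp only:)
  qed

  show thesis
  proof (rule that[of "Z n"])
    have \<beta>_le: "norm (\<beta> l \<omega>) \<le> 2 * Cb * T" if l: "l < n" and \<omega>: "\<omega> \<in> space P" for l \<omega>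
    proof -
      let ?V = "\<lambda>s. if s \<in> {0..T} then V s \<omega> else 0"
      have "\<beta> l \<omega> = (LINT r:{u l..u (Suc l)}|lborel. ?V r)"
        unfolding \<beta>_def using u_in[of l] u_in[of "Suc l"] l by (intro set_lebesgue_integral_cong) auto
      also have "norm \<dots> \<le> 2 * Cb * (u (Suc l) - u l)"
        using norm_V[of _ \<omega>] pos u(3)[OF l]
        by (intro cell_integral_bounds(1) path_measurable[OF progressive_V \<omega>]) auto
      also have "\<dots> \<le> 2 * Cb * T"
        using u_in[of l] u_in[of "Suc l"] l pos by (intro mult_left_mono) auto
      finally show ?thesis .
    qed
    have rate: "0 \<le> rate" using pos by (simp add: rate_def)
    have \<eta>_le: "norm (\<eta> l \<omega>) \<le> c" if "\<omega> \<in> space P" for l \<omega>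
      unfolding \<eta>_def using that by (rule H_le)
    note energy = energy_estimate[of u n D \<eta> c \<beta> "2 * Cb * T" rate \<kappa>,
        OF u0[OF le0] u(3) D_sets[OF less_imp_le] \<eta>_meas \<eta>_le \<beta>_meas \<beta>_le bound[unfolded Z_def] rate \<kappa>_nonneg,
        folded Z_def]
    show "integrable P (\<lambda>\<omega>. (norm (Z n \<omega>))\<^sup>2)" using energy(2) .
    show "Z n \<in> borel_measurable P" using measurable_F_P[OF energy(1) u0] by simp
    have "expectation (\<lambda>\<omega>. (norm (Z n \<omega>))\<^sup>2) \<le> \<kappa> * exp (rate * T)"
      using energy(3) u by simp
    also have "\<dots> \<le> (\<epsilon> * K0) * exp (rate * T)"
      using \<kappa>_le by (intro mult_right_mono) auto
    finally show "expectation (\<lambda>\<omega>. (norm (Z n \<omega>))\<^sup>2) \<le> \<epsilon> * (K0 * exp (rate * T))"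
      by simp
  next
    fix \<omega>
    assume \<omega>: "\<omega> \<in> space P"
      and X: "\<And>s. s \<in> {0..T} \<Longrightarrow> norm (X1 s \<omega>) \<le> N \<and> norm (X2 s \<omega>) \<le> N"
      and mod: "\<And>s s'. s \<in> {0..T} \<Longrightarrow> s' \<in> {0..T} \<Longrightarrow> \<bar>s - s'\<bar> \<le> \<delta>0 \<Longrightarrow> norm (Y s \<omega> - Y s' \<omega>) \<le> \<epsilon>"
      and HS: "(\<integral>\<^sup>+r\<in>{0..T}. ennreal ((norm (H r \<omega> - S r \<omega>))\<^sup>2) \<partial>lborel) \<le> ennreal \<epsilon>"
      and eqn: "\<And>t. t \<in> {0..T} \<Longrightarrow> norm (Y t \<omega> - ((LINT r:{0..t}|lborel. V r \<omega>) + I t \<omega>)) \<le> \<epsilon>"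
    let ?V = "\<lambda>s. if s \<in> {0..T} then V s \<omega> else 0" and ?S = "\<lambda>s. if s \<in> {0..T} then S s \<omega> else 0"
    have "set_integrable lborel {0..T} ?V"
      unfolding set_integrable_def
    proof (rule integrableI_bounded_set_indicator[where B="2 * Cb"])
      show "?V \<in> borel_measurable lborel" using path_measurable[OF progressive_V \<omega>] by simp
      show "emeasure lborel {0..T} < \<infinity>" using pos by simp
    qed (use norm_V[of _ \<omega>] pos in auto)
    then have Vint: "set_integrable lborel {0..T} (\<lambda>s. V s \<omega>)"
      by (rule set_integrable_cong[THEN iffD1, rotated -1]) auto
    have I_Suc: "I (u (Suc l)) \<omega> = I (u l) \<omega> + (W (u (Suc l)) \<omega> - W (u l) \<omega>) *\<^sub>R \<eta> l \<omega>" if l: "l < n" for l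
    proof -
      let ?J1 = "\<lambda>t. elementary_integral W m1 \<tau>1 \<xi>1 t \<omega>" and ?J2 = "\<lambda>t. elementary_integral W m2 \<tau>2 \<xi>2 t \<omega>"
      have "I (u (Suc l)) \<omega> - I (u l) \<omega> = (?J1 (u (Suc l)) - ?J1 (u l)) - (?J2 (u (Suc l)) - ?J2 (u l))"
        by (simp add: I_def)
      also have "\<dots> = (W (u (Suc l)) \<omega> - W (u l) \<omega>) *\<^sub>R \<eta> l \<omega>"
        unfolding \<eta>_def H_def scaleR_diff_right
        using elementary_integral_cell[OF el(1) no1[OF l] u(3)[OF l], of W \<omega>]
          elementary_integral_cell[OF el(2) no2[OF l] u(3)[OF l], of W \<omega>] by simp
      finally show ?thesis by (simp add: diff_eq_eq add.commute)
    qed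
    \<comment> \<open>At grid points the unfrozen scheme is the drift integral plus the elementary
      integral, so \<open>eqn\<close> is precisely the closeness demanded in
      \<open>G1\<close>.\<close>
    have sumB: "(\<Sum>j<i. B j \<omega>) = (LINT r:{0..u i}|lborel. V r \<omega>) + I (u i) \<omega>" if i: "i \<le> n" for i
    proof -
      have "(\<Sum>j<i. (W (u (Suc j)) \<omega> - W (u j) \<omega>) *\<^sub>R \<eta> j \<omega>) = I (u i) \<omega>"
        using i
      proof (induction i)
        case 0
        then show ?case using u elementary_integral_0[OF el(1)] elementary_integral_0[OF el(2)] by (simp add: I_def)
      next
        case (Suc i)
        then show ?case using I_Suc[of i] by simp
      qed
      then show ?thesis
        unfolding B_def sum.distrib \<beta>_def
        using LINT_cells[OF Vint u(3) u(1,2) i] by simp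
    qed
    have cell_meas: "(\<lambda>r. ennreal ((norm (\<eta> i \<omega> - S r \<omega>))\<^sup>2) * indicator {u i<..u (Suc i)} r) \<in> borel_measurable lborel"
      if i: "i < n" for i
    proof -
      have [measurable]: "?S \<in> borel_measurable borel" by (rule path_measurable[OF prog(3) \<omega>])
      have "(\<lambda>r. ennreal ((norm (\<eta> i \<omega> - S r \<omega>))\<^sup>2) * indicator {u i<..u (Suc i)} r)
          = (\<lambda>r. ennreal ((norm (\<eta> i \<omega> - ?S r))\<^sup>2) * indicator {u i<..u (Suc i)} r)"
        using u_in[of i] u_in[of "Suc i"] i by (auto simp: indicator_def fun_eq_iff)
      also have "\<dots> \<in> borel_measurable lborel" by measurable
      finally show ?thesis .
    qed
    have H_cell: "\<eta> i \<omega> = H r \<omega>" if i: "i < n" and r: "r \<in> {u i<..u (Suc i)}" for i r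
      unfolding \<eta>_def H_def
      using elementary_process_cell[OF el(1) no1[OF i] r] elementary_process_cell[OF el(2) no2[OF i] r] by simp
    have "(\<Sum>i<n. Q i \<omega>) \<le> (\<integral>\<^sup>+r\<in>{0..T}. ennreal ((norm (H r \<omega> - S r \<omega>))\<^sup>2) \<partial>lborel)"
      unfolding Q_def using H_cell by (intro sum_cells_le u cell_meas) auto
    then have "(\<Sum>i<n. Q i \<omega>) \<le> ennreal \<epsilon>" using HS by (rule order_trans)
    moreover have "G1 i \<omega>" if "i \<le> n" for i
      unfolding G1_def sumB[OF that] using X eqn u_in[OF that] by auto
    moreover have "G2 i s \<omega>" if "i < n" "s \<in> {u i..u (Suc i)}" for i s
    proof -
      have "s \<in> {0..T}" "u i \<in> {0..T}" using u_in[of i] u_in[of "Suc i"] that by auto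
      moreover have "\<bar>s - u i\<bar> \<le> \<delta>0" using that u(4)[of i] \<delta> by auto
      ultimately show ?thesis unfolding G2_def using X mod by auto
    qed
    ultimately have "\<omega> \<in> D n" using \<omega> by (auto simp: D_def G_def)
    then show "norm (Y T \<omega> - Z n \<omega>) \<le> \<epsilon>" using near0 u(2) by force
  qed
qed

end

section \<open>Passage to the limit along the elementary approximations\<close>

lemma elementary_process_path_measurable:
  fixes \<xi> :: "nat \<Rightarrow> 'w \<Rightarrow> 'e::{real_normed_vector, second_countable_topology}"
  shows "(\<lambda>r. elementary_process m \<tau> \<xi> r \<omega>) \<in> borel_measurable borel"
  unfolding elementary_process_def by measurable

lemma nn_integral_diff_diff_sq_le:
  fixes a b c d :: "real \<Rightarrow> 'e::{real_normed_vector, second_countable_topology}"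
  assumes [measurable]: "a \<in> borel_measurable borel" "b \<in> borel_measurable borel"
    "c \<in> borel_measurable borel" "d \<in> borel_measurable borel" "A \<in> sets borel"
  shows "(\<integral>\<^sup>+r\<in>A. ennreal ((norm ((a r - b r) - (c r - d r)))\<^sup>2) \<partial>lborel)
    \<le> 2 * (\<integral>\<^sup>+r\<in>A. ennreal ((norm (a r - c r))\<^sup>2) \<partial>lborel)
      + 2 * (\<integral>\<^sup>+r\<in>A. ennreal ((norm (b r - d r))\<^sup>2) \<partial>lborel)"
proof -
  have "ennreal ((norm ((a r - b r) - (c r - d r)))\<^sup>2)
      \<le> 2 * ennreal ((norm (a r - c r))\<^sup>2) + 2 * ennreal ((norm (b r - d r))\<^sup>2)" for r
  proof -
    have "(norm ((a r - b r) - (c r - d r)))\<^sup>2 \<le> 2 * (norm (a r - c r))\<^sup>2 + 2 * (norm (b r - d r))\<^sup>2"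
      using norm_diff_sq_bound[of "(a r - b r) - (c r - d r)" "a r - c r" "norm (b r - d r)"]
      by (simp add: algebra_simps norm_minus_commute)
    from ennreal_leI[OF this] show ?thesis by (simp add: ennreal_mult)
  qed
  then have "(\<integral>\<^sup>+r\<in>A. ennreal ((norm ((a r - b r) - (c r - d r)))\<^sup>2) \<partial>lborel)
      \<le> (\<integral>\<^sup>+r. 2 * (ennreal ((norm (a r - c r))\<^sup>2) * indicator A r)
        + 2 * (ennreal ((norm (b r - d r))\<^sup>2) * indicator A r) \<partial>lborel)"
    by (intro nn_integral_mono) (simp add: indicator_def)
  also have "\<dots> = 2 * (\<integral>\<^sup>+r\<in>A. ennreal ((norm (a r - c r))\<^sup>2) \<partial>lborel)
      + 2 * (\<integral>\<^sup>+r\<in>A. ennreal ((norm (b r - d r))\<^sup>2) \<partial>lborel)"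
    by (subst nn_integral_add) (simp_all add: nn_integral_cmult)
  finally show ?thesis .
qed

text \<open>The two time variables pass from rational to real one after the other. The distance
  \<delta> / 2 leaves room: rationals in a closed neighbourhood of that radius still have distance
  strictly below \<delta> from its centre.\<close>

lemma rational_modulus:
  fixes y :: "real \<Rightarrow> 'e::real_normed_vector"
  assumes y: "continuous_on {0..T} y" and T: "0 < T" and \<delta>: "0 < \<delta>"
    and rat: "\<And>s s'. \<lbrakk>s \<in> \<rat> \<inter> {0..T}; s' \<in> \<rat> \<inter> {0..T}; \<bar>s - s'\<bar> < \<delta>\<rbrakk> \<Longrightarrow> norm (y s - y s') \<le> \<epsilon>"
    and s: "s \<in> {0..T}" "s' \<in> {0..T}" "\<bar>s - s'\<bar> \<le> \<delta> / 2"
  shows "norm (y s - y s') \<le> \<epsilon>"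
proof -
  have half: "norm (y s - y s') \<le> \<epsilon>" if s: "s \<in> {0..T}" and s': "s' \<in> \<rat> \<inter> {0..T}" "\<bar>s - s'\<bar> \<le> \<delta> / 2" for s s'
  proof (rule continuous_le_on_rationals[where \<phi>="\<lambda>s. norm (y s - y s')"
        and a="max 0 (s' - \<delta> / 2)" and b="min T (s' + \<delta> / 2)"])
    show "continuous_on {max 0 (s' - \<delta> / 2)..min T (s' + \<delta> / 2)} (\<lambda>s. norm (y s - y s'))"
      by (intro continuous_intros continuous_on_subset[OF y]) auto
    show "max 0 (s' - \<delta> / 2) < min T (s' + \<delta> / 2)" using T \<delta> s' by auto
    have "s' - \<delta> / 2 \<le> s" "s \<le> s' + \<delta> / 2" using s'(2) by linarith+
    then show "s \<in> {max 0 (s' - \<delta> / 2)..min T (s' + \<delta> / 2)}" using s by auto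
    show "norm (y q - y s') \<le> \<epsilon>" if "q \<in> \<rat>" and q: "q \<in> {max 0 (s' - \<delta> / 2)..min T (s' + \<delta> / 2)}" for q
    proof (rule rat)
      have "s' - \<delta> / 2 \<le> q" "q \<le> s' + \<delta> / 2" using q by auto
      then show "\<bar>q - s'\<bar> < \<delta>" using \<delta> by linarith
    qed (use that s' in auto)
  qed
  show ?thesis
  proof (rule continuous_le_on_rationals[where \<phi>="\<lambda>s'. norm (y s - y s')"
        and a="max 0 (s - \<delta> / 2)" and b="min T (s + \<delta> / 2)"])
    show "continuous_on {max 0 (s - \<delta> / 2)..min T (s + \<delta> / 2)} (\<lambda>s'. norm (y s - y s'))"
      by (intro continuous_intros continuous_on_subset[OF y]) auto
    show "max 0 (s - \<delta> / 2) < min T (s + \<delta> / 2)" using T \<delta> s by auto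
    have "s - \<delta> / 2 \<le> s'" "s' \<le> s + \<delta> / 2" using s(3) by linarith+
    then show "s' \<in> {max 0 (s - \<delta> / 2)..min T (s + \<delta> / 2)}" using s(2) by auto
    show "norm (y s - y q) \<le> \<epsilon>" if "q \<in> \<rat>" and q: "q \<in> {max 0 (s - \<delta> / 2)..min T (s + \<delta> / 2)}" for q
    proof (rule half)
      have "s - \<delta> / 2 \<le> q" "q \<le> s + \<delta> / 2" using q by auto
      then show "\<bar>s - q\<bar> \<le> \<delta> / 2" by linarith
    qed (use that s(1) in auto)
  qed
qed

lemma (in finite_measure) tendsto_zero_in_probD:
  assumes "tendsto_zero_in_prob M Z" "0 < \<epsilon>" "0 < \<rho>"
  shows "\<forall>\<^sub>F k in sequentially. measure M {\<omega> \<in> space M. ennreal \<epsilon> < Z k \<omega>} < \<rho>"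
    and "{\<omega> \<in> space M. ennreal \<epsilon> < Z k \<omega>} \<in> sets M"
proof -
  have lim: "(\<lambda>k. measure M {\<omega> \<in> space M. ennreal \<epsilon> < Z k \<omega>}) \<longlonglongrightarrow> 0"
    and [measurable]: "Z k \<in> borel_measurable M"
    using assms by (auto simp: tendsto_zero_in_prob_def)
  show "\<forall>\<^sub>F k in sequentially. measure M {\<omega> \<in> space M. ennreal \<epsilon> < Z k \<omega>} < \<rho>"
    by (rule order_tendstoD(2)[OF lim assms(3)])
  show "{\<omega> \<in> space M. ennreal \<epsilon> < Z k \<omega>} \<in> sets M" by measurable
qed

context sde_pair
begin

text \<open>Almost all paths of \<open>Y\<close> are uniformly continuous on \<open>{0..T}\<close>,
  so the events that \<open>Y\<close> oscillates by more than \<epsilon> at scale 1 / (p + 1)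
  decrease to a null set, and continuity from above gives one of small measure. They use rational
  times in order to be measurable, which is why the final scale is halved.\<close>

lemma modulus_small:
  assumes \<epsilon>: "0 < \<epsilon>" and \<rho>: "0 < \<rho>"
  obtains \<delta> M where "0 < \<delta>" "M \<in> sets P" "measure P M < \<rho>"
    "AE \<omega> in P. \<omega> \<notin> M \<longrightarrow> (\<forall>s\<in>{0..T}. \<forall>s'\<in>{0..T}. \<bar>s - s'\<bar> \<le> \<delta> \<longrightarrow> norm (Y s \<omega> - Y s' \<omega>) \<le> \<epsilon>)"
proof -
  let ?Q = "\<rat> \<inter> {0..T}"
  define M where "M p = {\<omega> \<in> space P. \<not> (\<forall>s\<in>?Q. \<forall>s'\<in>?Q.
    \<bar>s - s'\<bar> < inverse (real (Suc p)) \<longrightarrow> norm (Y s \<omega> - Y s' \<omega>) \<le> \<epsilon>)}" for p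
  have Y_meas: "Y s \<in> borel_measurable P" if "s \<in> ?Q" for s
    using measurable_F_P[OF adapted_Y] that by auto
  have M_sets: "M p \<in> sets P" for p
  proof -
    have "Measurable.pred P (\<lambda>\<omega>. norm (Y s \<omega> - Y s' \<omega>) \<le> \<epsilon>)" if "s \<in> ?Q" "s' \<in> ?Q" for s s'
    proof -
      note [measurable] = Y_meas[OF that(1)] Y_meas[OF that(2)]
      show ?thesis by measurable
    qed
    then have "Measurable.pred P (\<lambda>\<omega>. \<not> (\<forall>s\<in>?Q. \<forall>s'\<in>?Q.
        \<bar>s - s'\<bar> < inverse (real (Suc p)) \<longrightarrow> norm (Y s \<omega> - Y s' \<omega>) \<le> \<epsilon>))"
      by (intro pred_intros_logic(2) pred_countable_Ball countable_Int1 countable_rat pred_intros_imp')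
    then show ?thesis by (simp add: M_def pred_def)
  qed
  have dec: "decseq M"
  proof (rule decseq_SucI)
    fix p
    have "inverse (real (Suc (Suc p))) < inverse (real (Suc p))" by simp
    then have "x < inverse (real (Suc p))" if "x < inverse (real (Suc (Suc p)))" for x
      using that by (rule less_trans[rotated])
    then show "M (Suc p) \<subseteq> M p" unfolding M_def by blast
  qed
  have cont: "AE \<omega> in P. continuous_on {0..T} (\<lambda>t. Y t \<omega>)"
    using continuous_Y by eventually_elim (auto intro: continuous_on_subset)
  have "AE \<omega> in P. \<omega> \<notin> (\<Inter>p. M p)"
    using cont
  proof eventually_elim
    case (elim \<omega>)
    then have "uniformly_continuous_on {0..T} (\<lambda>t. Y t \<omega>)"
      by (intro compact_uniformly_continuous) auto
    then obtain d where d: "0 < d"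
      "\<And>s s'. s \<in> {0..T} \<Longrightarrow> s' \<in> {0..T} \<Longrightarrow> dist s' s < d \<Longrightarrow> dist (Y s' \<omega>) (Y s \<omega>) < \<epsilon>"
      using \<epsilon> unfolding uniformly_continuous_on_def by meson
    obtain p where "inverse (real (Suc p)) < d" using reals_Archimedean[OF d(1)] by blast
    then have "\<omega> \<notin> M p"
      using d(2) by (force simp: M_def dist_norm)
    then show ?case by blast
  qed
  then have "measure P (\<Inter>p. M p) = 0"
    using M_sets by (subst measure_eq_AE[where B="{}"]) auto
  moreover have "(\<lambda>p. measure P (M p)) \<longlonglongrightarrow> measure P (\<Inter>p. M p)"
    using M_sets dec by (intro finite_Lim_measure_decseq) auto
  ultimately have "(\<lambda>p. measure P (M p)) \<longlonglongrightarrow> 0" by simp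
  from order_tendstoD(2)[OF this \<rho>] obtain p where p: "measure P (M p) < \<rho>"
    unfolding eventually_sequentially by blast
  show thesis
  proof (rule that[of "inverse (real (Suc p)) / 2" "M p"])
    show "AE \<omega> in P. \<omega> \<notin> M p \<longrightarrow> (\<forall>s\<in>{0..T}. \<forall>s'\<in>{0..T}.
        \<bar>s - s'\<bar> \<le> inverse (real (Suc p)) / 2 \<longrightarrow> norm (Y s \<omega> - Y s' \<omega>) \<le> \<epsilon>)"
      using cont AE_space
    proof eventually_elim
      case (elim \<omega>)
      show ?case
      proof (intro impI ballI)
        fix s s' assume \<omega>: "\<omega> \<notin> M p" and s: "s \<in> {0..T}" "s' \<in> {0..T}" "\<bar>s - s'\<bar> \<le> inverse (real (Suc p)) / 2"
        have rat: "norm (Y q \<omega> - Y q' \<omega>) \<le> \<epsilon>"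
          if "q \<in> ?Q" "q' \<in> ?Q" "\<bar>q - q'\<bar> < inverse (real (Suc p))" for q q'
          using \<omega> elim(2) that unfolding M_def by blast
        show "norm (Y s \<omega> - Y s' \<omega>) \<le> \<epsilon>"
          by (rule rational_modulus[OF elim(1) pos(5) _ rat s]) auto
      qed
    qed
  qed (use p M_sets in auto)
qed

text \<open>If both solutions stay in the ball and the norm of \<open>Y T\<close> is at least 2 *
  \<alpha>, then, up to a null set, a condition of \<open>stopped_estimate\<close> fails or the norm
  of \<open>Z\<close> is at least \<alpha>. Failures are rare by the choice of the modulus and of
  the index \<open>k\<close>; a large \<open>Z\<close> is rare by Markov's inequality, since its
  second moment is at most \<epsilon> times a constant independent of \<open>k\<close>.\<close>

lemma terminal_zero:
  fixes H1 H2 I1 I2 :: "real \<Rightarrow> 'w \<Rightarrow> 'b"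
  assumes ito: "has_ito_integral P F W H1 I1" "has_ito_integral P F W H2 I2"
    and S: "\<And>t \<omega>. S t \<omega> = H1 t \<omega> - H2 t \<omega>"
    and eqn: "AE \<omega> in P. (\<forall>s\<in>{0..T}. norm (X1 s \<omega>) \<le> N \<and> norm (X2 s \<omega>) \<le> N) \<longrightarrow>
      (\<forall>t\<in>{0..T}. Y t \<omega> = (LINT r:{0..t}|lborel. V r \<omega>) + (I1 t \<omega> - I2 t \<omega>))"
  shows "AE \<omega> in P. (\<forall>s\<in>{0..T}. norm (X1 s \<omega>) \<le> N \<and> norm (X2 s \<omega>) \<le> N) \<longrightarrow> Y T \<omega> = 0"
proof -
  let ?Q = "\<rat> \<inter> {0..T}"
  define A where "A \<alpha> = {\<omega> \<in> space P. (\<forall>s\<in>?Q. norm (X1 s \<omega>) \<le> N \<and> norm (X2 s \<omega>) \<le> N) \<and> 2 * \<alpha> \<le> norm (Y T \<omega>)}" for \<alpha>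
  have A_sets: "A \<alpha> \<in> sets P" for \<alpha>
  proof -
    have "Measurable.pred P (\<lambda>\<omega>. norm (X1 s \<omega>) \<le> N \<and> norm (X2 s \<omega>) \<le> N)" if "s \<in> ?Q" for s
    proof -
      have s: "0 \<le> s" using that by simp
      note [measurable] = measurable_F_P[OF progressive_adapted[OF prog(1) s] s]
        measurable_F_P[OF progressive_adapted[OF prog(2) s] s]
      show ?thesis by measurable
    qed
    then have "Measurable.pred P (\<lambda>\<omega>. \<forall>s\<in>?Q. norm (X1 s \<omega>) \<le> N \<and> norm (X2 s \<omega>) \<le> N)"
      by (rule pred_countable_Ball[OF countable_Int1[OF countable_rat]])
    moreover have [measurable]: "Y T \<in> borel_measurable P"
      using measurable_F_P[OF adapted_Y] pos by auto
    moreover have "Measurable.pred P (\<lambda>\<omega>. 2 * \<alpha> \<le> norm (Y T \<omega>))" by measurable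
    ultimately have "Measurable.pred P (\<lambda>\<omega>. (\<forall>s\<in>?Q. norm (X1 s \<omega>) \<le> N \<and> norm (X2 s \<omega>) \<le> N) \<and> 2 * \<alpha> \<le> norm (Y T \<omega>))"
      by (intro pred_intros_logic(3))
    then show ?thesis by (simp add: A_def pred_def)
  qed
  have prog12: "progressive_process F H1" "progressive_process F H2"
    using ito by (auto simp: has_ito_integral_def)
  obtain m1 \<tau>1 \<xi>1 where el1: "\<And>k. elementary_data P F (m1 k) (\<tau>1 k) (\<xi>1 k)"
    and H1: "tendsto_zero_in_prob P (\<lambda>k \<omega>. \<integral>\<^sup>+r\<in>{0..T}.
        ennreal ((norm (elementary_process (m1 k) (\<tau>1 k) (\<xi>1 k) r \<omega> - H1 r \<omega>))\<^sup>2) \<partial>lborel)"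
    and I1: "tendsto_zero_in_prob P (\<lambda>k \<omega>. SUP t\<in>{0..T}.
        ennreal (norm (elementary_integral W (m1 k) (\<tau>1 k) (\<xi>1 k) t \<omega> - I1 t \<omega>)))"
    using ito(1) pos(5) unfolding has_ito_integral_def by meson
  obtain m2 \<tau>2 \<xi>2 where el2: "\<And>k. elementary_data P F (m2 k) (\<tau>2 k) (\<xi>2 k)"
    and H2: "tendsto_zero_in_prob P (\<lambda>k \<omega>. \<integral>\<^sup>+r\<in>{0..T}.
        ennreal ((norm (elementary_process (m2 k) (\<tau>2 k) (\<xi>2 k) r \<omega> - H2 r \<omega>))\<^sup>2) \<partial>lborel)"
    and I2: "tendsto_zero_in_prob P (\<lambda>k \<omega>. SUP t\<in>{0..T}.
        ennreal (norm (elementary_integral W (m2 k) (\<tau>2 k) (\<xi>2 k) t \<omega> - I2 t \<omega>)))"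
    using ito(2) pos(5) unfolding has_ito_integral_def by meson
  have small: "measure P (A \<alpha>) \<le> \<rho>" if \<alpha>: "0 < \<alpha>" and \<rho>: "0 < \<rho>" for \<alpha> \<rho>
  proof -
    define C where "C = K0 * exp (rate * T)"
    have C: "0 \<le> C"
      unfolding C_def K0_def using pos J_nonneg by (intro mult_nonneg_nonneg add_nonneg_nonneg) auto
    \<comment> \<open>\<epsilon> \<le> \<alpha> loses at most half of 2 * \<alpha> when
      \<open>Y T\<close> is replaced by \<open>Z\<close>. The last bound gives \<epsilon> * C \<le>
      \<rho> / 2 * \<alpha>^2, that is, probability \<rho> / 2 in Markov's inequality; the 1 in C +
      1 keeps the denominator positive.\<close>
    define \<epsilon> where "\<epsilon> = min (min 1 \<alpha>) (\<rho> * \<alpha>\<^sup>2 / (2 * (C + 1)))"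
    have \<epsilon>: "0 < \<epsilon>" "\<epsilon> \<le> 1" "\<epsilon> \<le> \<alpha>" "\<epsilon> \<le> \<rho> * \<alpha>\<^sup>2 / (2 * (C + 1))"
      using \<alpha> \<rho> C by (auto simp: \<epsilon>_def)
    have "\<epsilon> * (2 * (C + 1)) \<le> \<rho> * \<alpha>\<^sup>2"
      using \<epsilon>(4) C pos_le_divide_eq[of "2 * (C + 1)"] by simp
    then have \<epsilon>C: "\<epsilon> * C \<le> \<rho> / 2 * \<alpha>\<^sup>2" using \<epsilon>(1) by (simp add: algebra_simps)
    obtain \<delta> M where \<delta>: "0 < \<delta>" and M: "M \<in> sets P" "measure P M < \<rho> / 4"
      "AE \<omega> in P. \<omega> \<notin> M \<longrightarrow> (\<forall>s\<in>{0..T}. \<forall>s'\<in>{0..T}. \<bar>s - s'\<bar> \<le> \<delta> \<longrightarrow> norm (Y s \<omega> - Y s' \<omega>) \<le> \<epsilon>)"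
      using modulus_small[OF \<epsilon>(1), of "\<rho> / 4"] \<rho> by auto
    let ?E1 = "\<lambda>k r \<omega>. elementary_process (m1 k) (\<tau>1 k) (\<xi>1 k) r \<omega>"
    let ?E2 = "\<lambda>k r \<omega>. elementary_process (m2 k) (\<tau>2 k) (\<xi>2 k) r \<omega>"
    let ?J1 = "\<lambda>k t \<omega>. elementary_integral W (m1 k) (\<tau>1 k) (\<xi>1 k) t \<omega>"
    let ?J2 = "\<lambda>k t \<omega>. elementary_integral W (m2 k) (\<tau>2 k) (\<xi>2 k) t \<omega>"
    \<comment> \<open>The integrands are compared in squared norm, where splitting costs a factor 2,
      hence \<epsilon> / 4; the errors of the integrals simply add, hence \<epsilon> / 2. The
      probabilities will add up to at most \<rho> / 2 + \<rho> / 4 + 4 * \<rho> / 16 =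
      \<rho>.\<close>
    let ?B1 = "\<lambda>k. {\<omega> \<in> space P. ennreal (\<epsilon> / 4) < (\<integral>\<^sup>+r\<in>{0..T}. ennreal ((norm (?E1 k r \<omega> - H1 r \<omega>))\<^sup>2) \<partial>lborel)}"
    let ?B2 = "\<lambda>k. {\<omega> \<in> space P. ennreal (\<epsilon> / 4) < (\<integral>\<^sup>+r\<in>{0..T}. ennreal ((norm (?E2 k r \<omega> - H2 r \<omega>))\<^sup>2) \<partial>lborel)}"
    let ?B3 = "\<lambda>k. {\<omega> \<in> space P. ennreal (\<epsilon> / 2) < (SUP t\<in>{0..T}. ennreal (norm (?J1 k t \<omega> - I1 t \<omega>)))}"
    let ?B4 = "\<lambda>k. {\<omega> \<in> space P. ennreal (\<epsilon> / 2) < (SUP t\<in>{0..T}. ennreal (norm (?J2 k t \<omega> - I2 t \<omega>)))}"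
    have e: "0 < \<epsilon> / 4" "0 < \<epsilon> / 2" "0 < \<rho> / 16" using \<epsilon> \<rho> by auto
    have "\<forall>\<^sub>F k in sequentially. measure P (?B1 k) < \<rho> / 16 \<and> measure P (?B2 k) < \<rho> / 16
        \<and> measure P (?B3 k) < \<rho> / 16 \<and> measure P (?B4 k) < \<rho> / 16"
      using tendsto_zero_in_probD(1)[OF H1 e(1,3)] tendsto_zero_in_probD(1)[OF H2 e(1,3)]
        tendsto_zero_in_probD(1)[OF I1 e(2,3)] tendsto_zero_in_probD(1)[OF I2 e(2,3)]
      by eventually_elim blast
    then obtain k where k: "measure P (?B1 k) < \<rho> / 16" "measure P (?B2 k) < \<rho> / 16"
        "measure P (?B3 k) < \<rho> / 16" "measure P (?B4 k) < \<rho> / 16"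
      unfolding eventually_sequentially by blast
    have B_sets: "?B1 k \<in> sets P" "?B2 k \<in> sets P" "?B3 k \<in> sets P" "?B4 k \<in> sets P"
      using tendsto_zero_in_probD(2)[OF H1 e(1,3)] tendsto_zero_in_probD(2)[OF H2 e(1,3)]
        tendsto_zero_in_probD(2)[OF I1 e(2,3)] tendsto_zero_in_probD(2)[OF I2 e(2,3)] by blast+
    obtain Z where Z: "Z \<in> borel_measurable P" "integrable P (\<lambda>\<omega>. (norm (Z \<omega>))\<^sup>2)"
        "expectation (\<lambda>\<omega>. (norm (Z \<omega>))\<^sup>2) \<le> \<epsilon> * C"
      and Z_near: "\<And>\<omega>. \<lbrakk>\<omega> \<in> space P;
        \<And>s. s \<in> {0..T} \<Longrightarrow> norm (X1 s \<omega>) \<le> N \<and> norm (X2 s \<omega>) \<le> N;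
        \<And>s s'. s \<in> {0..T} \<Longrightarrow> s' \<in> {0..T} \<Longrightarrow> \<bar>s - s'\<bar> \<le> \<delta> \<Longrightarrow> norm (Y s \<omega> - Y s' \<omega>) \<le> \<epsilon>;
        (\<integral>\<^sup>+r\<in>{0..T}. ennreal ((norm (?E1 k r \<omega> - ?E2 k r \<omega> - S r \<omega>))\<^sup>2) \<partial>lborel) \<le> ennreal \<epsilon>;
        \<And>t. t \<in> {0..T} \<Longrightarrow> norm (Y t \<omega> - ((LINT r:{0..t}|lborel. V r \<omega>) + (?J1 k t \<omega> - ?J2 k t \<omega>))) \<le> \<epsilon>\<rbrakk>
      \<Longrightarrow> norm (Y T \<omega> - Z \<omega>) \<le> \<epsilon>"
      unfolding C_def using stopped_estimate[OF el1[of k] el2[of k] \<epsilon>(1,2) \<delta>] by blast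
    let ?BZ = "{\<omega> \<in> space P. \<alpha>\<^sup>2 \<le> (norm (Z \<omega>))\<^sup>2}"
    have BZ_sets: "?BZ \<in> sets P" using Z(1) by measurable
    have BZ: "measure P ?BZ \<le> \<rho> / 2"
    proof -
      have "measure P ?BZ \<le> expectation (\<lambda>\<omega>. (norm (Z \<omega>))\<^sup>2) / \<alpha>\<^sup>2"
        by (rule integral_Markov_inequality_measure[OF Z(2), of "{}"]) (use \<alpha> in auto)
      also have "\<dots> \<le> (\<rho> / 2 * \<alpha>\<^sup>2) / \<alpha>\<^sup>2"
        using Z(3) \<epsilon>C by (intro divide_right_mono) auto
      finally show ?thesis using \<alpha> by simp
    qed
    let ?U = "?BZ \<union> M \<union> ?B1 k \<union> ?B2 k \<union> ?B3 k \<union> ?B4 k"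
    have U_sets: "?U \<in> sets P" using BZ_sets M B_sets by (intro sets.Un)
    have "AE \<omega> in P. \<omega> \<in> A \<alpha> \<longrightarrow> \<omega> \<in> ?U"
      using continuous_Y M(3) eqn AE_space
    proof eventually_elim
      case (elim \<omega>)
      show ?case
      proof (intro impI, rule ccontr)
        assume \<omega>A: "\<omega> \<in> A \<alpha>" and notU: "\<omega> \<notin> ?U"
        have sub: "{0..T} \<subseteq> {0..}" by auto
        have X: "norm (X1 s \<omega>) \<le> N \<and> norm (X2 s \<omega>) \<le> N" if s: "s \<in> {0..T}" for s
        proof
          show "norm (X1 s \<omega>) \<le> N"
            by (rule continuous_le_on_rationals[OF _ pos(5) _ s])
              (use elim(1) \<omega>A in \<open>auto intro!: continuous_intros intro: continuous_on_subset[OF _ sub] simp: A_def\<close>)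
          show "norm (X2 s \<omega>) \<le> N"
            by (rule continuous_le_on_rationals[OF _ pos(5) _ s])
              (use elim(1) \<omega>A in \<open>auto intro!: continuous_intros intro: continuous_on_subset[OF _ sub] simp: A_def\<close>)
        qed
        have Yeq: "Y t \<omega> = (LINT r:{0..t}|lborel. V r \<omega>) + (I1 t \<omega> - I2 t \<omega>)" if "t \<in> {0..T}" for t
          using elim(3) X that by blast
        let ?h1 = "\<lambda>r. if r \<in> {0..T} then H1 r \<omega> else 0" and ?h2 = "\<lambda>r. if r \<in> {0..T} then H2 r \<omega> else 0"
        have "(\<integral>\<^sup>+r\<in>{0..T}. ennreal ((norm (?E1 k r \<omega> - ?E2 k r \<omega> - S r \<omega>))\<^sup>2) \<partial>lborel)
            = (\<integral>\<^sup>+r\<in>{0..T}. ennreal ((norm ((?E1 k r \<omega> - ?E2 k r \<omega>) - (?h1 r - ?h2 r)))\<^sup>2) \<partial>lborel)"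
          by (intro nn_integral_cong) (auto simp: S indicator_def)
        also have "\<dots> \<le> 2 * (\<integral>\<^sup>+r\<in>{0..T}. ennreal ((norm (?E1 k r \<omega> - ?h1 r))\<^sup>2) \<partial>lborel)
            + 2 * (\<integral>\<^sup>+r\<in>{0..T}. ennreal ((norm (?E2 k r \<omega> - ?h2 r))\<^sup>2) \<partial>lborel)"
          using path_measurable[OF prog12(1)] path_measurable[OF prog12(2)] elim(4)
          by (intro nn_integral_diff_diff_sq_le elementary_process_path_measurable) auto
        also have "(\<integral>\<^sup>+r\<in>{0..T}. ennreal ((norm (?E1 k r \<omega> - ?h1 r))\<^sup>2) \<partial>lborel)
            = (\<integral>\<^sup>+r\<in>{0..T}. ennreal ((norm (?E1 k r \<omega> - H1 r \<omega>))\<^sup>2) \<partial>lborel)"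
          by (intro nn_integral_cong) (auto simp: indicator_def)
        also have "(\<integral>\<^sup>+r\<in>{0..T}. ennreal ((norm (?E2 k r \<omega> - ?h2 r))\<^sup>2) \<partial>lborel)
            = (\<integral>\<^sup>+r\<in>{0..T}. ennreal ((norm (?E2 k r \<omega> - H2 r \<omega>))\<^sup>2) \<partial>lborel)"
          by (intro nn_integral_cong) (auto simp: indicator_def)
        also have "2 * (\<integral>\<^sup>+r\<in>{0..T}. ennreal ((norm (?E1 k r \<omega> - H1 r \<omega>))\<^sup>2) \<partial>lborel)
            + 2 * (\<integral>\<^sup>+r\<in>{0..T}. ennreal ((norm (?E2 k r \<omega> - H2 r \<omega>))\<^sup>2) \<partial>lborel)
            \<le> 2 * ennreal (\<epsilon> / 4) + 2 * ennreal (\<epsilon> / 4)"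
          using notU elim(4) by (intro add_mono mult_left_mono) auto
        also have "2 * ennreal (\<epsilon> / 4) = ennreal (\<epsilon> / 2)"
          using ennreal_mult[of 2 "\<epsilon> / 4"] \<epsilon> by simp
        also have "ennreal (\<epsilon> / 2) + ennreal (\<epsilon> / 2) = ennreal \<epsilon>"
          using \<epsilon> by (simp flip: ennreal_plus)
        finally have HS: "(\<integral>\<^sup>+r\<in>{0..T}. ennreal ((norm (?E1 k r \<omega> - ?E2 k r \<omega> - S r \<omega>))\<^sup>2) \<partial>lborel) \<le> ennreal \<epsilon>"
          .
        have J1: "norm (?J1 k t \<omega> - I1 t \<omega>) \<le> \<epsilon> / 2" if "t \<in> {0..T}" for t
        proof -
          have "(SUP t\<in>{0..T}. ennreal (norm (?J1 k t \<omega> - I1 t \<omega>))) \<le> ennreal (\<epsilon> / 2)"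
            using notU elim(4) by auto
          then have "ennreal (norm (?J1 k t \<omega> - I1 t \<omega>)) \<le> ennreal (\<epsilon> / 2)"
            using SUP_upper[OF that] order_trans by blast
          then show ?thesis using e by simp
        qed
        have J2: "norm (?J2 k t \<omega> - I2 t \<omega>) \<le> \<epsilon> / 2" if "t \<in> {0..T}" for t
        proof -
          have "(SUP t\<in>{0..T}. ennreal (norm (?J2 k t \<omega> - I2 t \<omega>))) \<le> ennreal (\<epsilon> / 2)"
            using notU elim(4) by auto
          then have "ennreal (norm (?J2 k t \<omega> - I2 t \<omega>)) \<le> ennreal (\<epsilon> / 2)"
            using SUP_upper[OF that] order_trans by blast
          then show ?thesis using e by simp
        qed
        have eqn': "norm (Y t \<omega> - ((LINT r:{0..t}|lborel. V r \<omega>) + (?J1 k t \<omega> - ?J2 k t \<omega>))) \<le> \<epsilon>"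
          if t: "t \<in> {0..T}" for t
        proof -
          have eq: "Y t \<omega> - ((LINT r:{0..t}|lborel. V r \<omega>) + (?J1 k t \<omega> - ?J2 k t \<omega>))
              = (?J2 k t \<omega> - I2 t \<omega>) - (?J1 k t \<omega> - I1 t \<omega>)"
            unfolding Yeq[OF t] by (simp add: algebra_simps)
          show ?thesis
            unfolding eq
            using J1[OF t] J2[OF t] norm_triangle_ineq4[of "?J2 k t \<omega> - I2 t \<omega>" "?J1 k t \<omega> - I1 t \<omega>"] by linarith
        qed
        have "norm (Y T \<omega> - Z \<omega>) \<le> \<epsilon>"
          using elim(2,4) X notU HS eqn' by (intro Z_near) auto
        then have "\<alpha> \<le> norm (Z \<omega>)"
          using \<omega>A \<epsilon>(3) norm_triangle_ineq2[of "Y T \<omega>" "Z \<omega>"] by (auto simp: A_def)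
        then have "\<omega> \<in> ?BZ" using elim(4) \<alpha> by (auto intro: power_mono)
        then show False using notU by blast
      qed
    qed
    then have "measure P (A \<alpha>) \<le> measure P ?U"
      by (rule finite_measure_mono_AE[OF _ U_sets])
    also have "\<dots> \<le> measure P ?BZ + measure P M + measure P (?B1 k) + measure P (?B2 k) + measure P (?B3 k) + measure P (?B4 k)"
      using BZ_sets M(1) B_sets
      by (intro order_trans[OF measure_Un_le] add_mono order_refl sets.Un) auto
    also have "\<dots> \<le> \<rho>" using BZ M(2) k by linarith
    finally show ?thesis .
  qed
  \<comment> \<open>For each \<alpha> the event is null because \<rho> is arbitrary; the values 1 /
    (p + 1) of \<alpha> exhaust the case that \<open>Y T\<close> is nonzero.\<close>
  have "AE \<omega> in P. \<forall>p::nat. \<omega> \<notin> A (inverse (real (Suc p)))"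
  proof (rule AE_all_countable[THEN iffD2], rule allI)
    fix p :: nat
    let ?A = "A (inverse (real (Suc p)))"
    have "measure P ?A \<le> 0"
      by (rule field_le_epsilon) (use small[of "inverse (real (Suc p))"] in auto)
    then have "measure P ?A = 0" using measure_nonneg[of P ?A] by linarith
    then have "?A \<in> null_sets P" using A_sets by (auto simp: emeasure_eq_measure)
    then show "AE \<omega> in P. \<omega> \<notin> ?A" by (rule AE_not_in)
  qed
  then show ?thesis
    using AE_space
  proof eventually_elim
    case (elim \<omega>)
    show ?case
    proof (intro impI, rule ccontr)
      assume X: "\<forall>s\<in>{0..T}. norm (X1 s \<omega>) \<le> N \<and> norm (X2 s \<omega>) \<le> N" and "Y T \<omega> \<noteq> 0"
      then have "0 < norm (Y T \<omega>) / 2" by simp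
      then obtain p where "inverse (real (Suc p)) < norm (Y T \<omega>) / 2" using reals_Archimedean by blast
      then have "\<omega> \<in> A (inverse (real (Suc p)))" using X elim(2) by (auto simp: A_def)
      then show False using elim(1) by blast
    qed
  qed
qed

end

section \<open>From one ball and one time to all paths and all times\<close>

theorem theorem4p6:
  fixes j1 :: "'e1::{real_inner, banach, second_countable_topology} \<Rightarrow>
               'e0::{real_inner, banach, second_countable_topology}"
    and j0 :: "'e0 \<Rightarrow> 'em::{real_inner, banach, second_countable_topology}"
    and j :: "'e1 \<Rightarrow> 'em"
    and \<theta> M C R G L K :: real
    and e :: "nat \<Rightarrow> 'e1"
    and Pr :: "nat \<Rightarrow> 'em \<Rightarrow> 'e1"
    and b \<sigma> :: "'e0 \<Rightarrow> 'em"
    and b\<^sub>n \<sigma>\<^sub>n :: "nat \<Rightarrow> 'e1 \<Rightarrow> 'e1"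
    and g f :: "'e1 \<Rightarrow> real"
    and k h :: "real \<Rightarrow> real"
    and P :: "'w measure"
    and F :: "real \<Rightarrow> 'w measure"
    and W :: "real \<Rightarrow> 'w \<Rightarrow> real"
    and X\<^sub>0 :: "'w \<Rightarrow> 'e1"
    and X\<^sub>1 X\<^sub>2 :: "real \<Rightarrow> 'w \<Rightarrow> 'e0"
    and T :: real
  defines "j \<equiv> j0 \<circ> j1"
    and "Pr \<equiv> galerkin_proj j e"
    and "b\<^sub>n \<equiv> \<lambda>n x. Pr n (b (j1 x))"
    and "\<sigma>\<^sub>n \<equiv> \<lambda>n x. Pr n (\<sigma> (j1 x))"
  assumes emb1: "compact_dense_embedding j1"
    and emb0: "dense_embedding j0"
    and theta: "0 < \<theta>" "\<theta> < 1"
    and M: "M > 0"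
    and interpolation:
      "\<And>v. norm (j1 v) \<le> M * norm v powr (1 - \<theta>) * norm (j v) powr \<theta>"
    and span_dense: "closure (j ` span (e ` {1..})) = UNIV"
    and C: "C > 0"
    and proj_bound: "\<And>n x. n \<ge> 1 \<Longrightarrow> norm (Pr n (j x)) \<le> C * norm x"
    and b_borel: "b \<in> borel_measurable borel"
    and sigma_borel: "\<sigma> \<in> borel_measurable borel"
    and b_a: "continuous_on UNIV b" "bounded_on_balls b"
    and R: "R \<ge> 1"
    and g: "g \<in> borel_measurable borel" "\<And>x. g x \<ge> 0" "bounded_on_balls g"
    and b_b: "\<And>n x. \<lbrakk>n \<ge> 1; x \<in> galerkin_space e n; norm x \<ge> R\<rbrakk> \<Longrightarrow>
                inner (b\<^sub>n n x) x \<le> g x * (norm x)\<^sup>2"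
    and b_c: "\<And>n. n \<ge> 1 \<Longrightarrow> locally_lipschitz_on (galerkin_space e n) (b\<^sub>n n)"
    and b_e: "mono k" "\<And>r. k r \<ge> 0"
      "\<And>x y. inner (b x - b y) (j0 (x - y)) \<le>
                k (max (norm x) (norm y)) * (norm (j0 (x - y)))\<^sup>2"
    and sigma_a: "continuous_on UNIV \<sigma>" "bounded_on_balls \<sigma>"
    and f: "f \<in> borel_measurable borel" "bounded_on_balls f"
    and GL: "G > 0" "L > 0"
    and sigma_b:
      "\<And>x. \<lbrakk>norm x \<ge> R; g x > G\<rbrakk> \<Longrightarrow> \<sigma> (j1 x) = j (f x *\<^sub>R x)"
      "\<And>x. \<lbrakk>norm x \<ge> R; g x \<le> G\<rbrakk> \<Longrightarrow> \<exists>y. \<sigma> (j1 x) = j y \<and> norm y \<le> L * norm x"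
    and K: "K \<ge> 0"
    and sigma_c: "\<And>x. \<lbrakk>norm x \<ge> R; g x > G\<rbrakk> \<Longrightarrow> \<bar>f x\<bar>\<^sup>2 \<ge> 2 * g x - K"
    and sigma_d: "\<And>n. n \<ge> 1 \<Longrightarrow> locally_lipschitz_on (galerkin_space e n) (\<sigma>\<^sub>n n)"
    and sigma_e: "mono h" "\<And>r. h r \<ge> 0"
      "\<And>x y. norm (\<sigma> x - \<sigma> y) \<le> h (max (norm x) (norm y)) * norm (j0 (x - y))"
    and space: "usual_filtered_prob_space P F"
    and W: "brownian_motion P F W"
    and b_d: "X\<^sub>0 \<in> borel_measurable P" "indep_of_process P X\<^sub>0 W"
    and X1: "sde_solution j0 b \<sigma> P F W X\<^sub>1" "AE \<omega> in P. X\<^sub>1 0 \<omega> = j1 (X\<^sub>0 \<omega>)"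
    and X2: "sde_solution j0 b \<sigma> P F W X\<^sub>2" "AE \<omega> in P. X\<^sub>2 0 \<omega> = j1 (X\<^sub>0 \<omega>)"
    and T: "T > 0"
  shows "measure P {\<omega> \<in> space P. \<forall>t\<in>{0..T}. X\<^sub>1 t \<omega> = X\<^sub>2 t \<omega>} = 1"
proof -
  have P: "prob_space P" "complete_measure P"
    using space by (auto simp: usual_filtered_prob_space_def)
  interpret brownian_filtration P F W
    by (intro brownian_filtration.intro brownian_filtration_axioms.intro P(1) space W)
  have j0: "bounded_linear j0" "inj j0" using emb0 by (auto simp: dense_embedding_def)
  have prog: "progressive_process F X\<^sub>1" "progressive_process F X\<^sub>2"
    and cont: "ae_continuous_paths P X\<^sub>1" "ae_continuous_paths P X\<^sub>2"
    using X1(1) X2(1) by (auto simp: sde_solution_def)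
  obtain I1 where I1: "has_ito_integral P F W (\<lambda>r \<omega>. \<sigma> (X\<^sub>1 r \<omega>)) I1"
    and eq1: "AE \<omega> in P. \<forall>t\<ge>0. j0 (X\<^sub>1 t \<omega>) = j0 (X\<^sub>1 0 \<omega>) + (LINT r:{0..t}|lborel. b (X\<^sub>1 r \<omega>)) + I1 t \<omega>"
    using X1(1) unfolding sde_solution_def by blast
  have "AE \<omega> in P. \<forall>T>0. set_integrable lborel {0..T} (\<lambda>r. b (X\<^sub>1 r \<omega>)) \<and>
      set_borel_measurable lborel {0..T} (\<lambda>r. \<sigma> (X\<^sub>1 r \<omega>)) \<and>
      set_integrable lborel {0..T} (\<lambda>r. (norm (\<sigma> (X\<^sub>1 r \<omega>)))\<^sup>2)"
    using X1(1) unfolding sde_solution_def by blast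
  then have int1: "AE \<omega> in P. \<forall>T>0. set_integrable lborel {0..T} (\<lambda>r. b (X\<^sub>1 r \<omega>))"
    by eventually_elim blast
  obtain I2 where I2: "has_ito_integral P F W (\<lambda>r \<omega>. \<sigma> (X\<^sub>2 r \<omega>)) I2"
    and eq2: "AE \<omega> in P. \<forall>t\<ge>0. j0 (X\<^sub>2 t \<omega>) = j0 (X\<^sub>2 0 \<omega>) + (LINT r:{0..t}|lborel. b (X\<^sub>2 r \<omega>)) + I2 t \<omega>"
    using X2(1) unfolding sde_solution_def by blast
  have "AE \<omega> in P. \<forall>T>0. set_integrable lborel {0..T} (\<lambda>r. b (X\<^sub>2 r \<omega>)) \<and>
      set_borel_measurable lborel {0..T} (\<lambda>r. \<sigma> (X\<^sub>2 r \<omega>)) \<and>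
      set_integrable lborel {0..T} (\<lambda>r. (norm (\<sigma> (X\<^sub>2 r \<omega>)))\<^sup>2)"
    using X2(1) unfolding sde_solution_def by blast
  then have int2: "AE \<omega> in P. \<forall>T>0. set_integrable lborel {0..T} (\<lambda>r. b (X\<^sub>2 r \<omega>))"
    by eventually_elim blast
  let ?S = "\<lambda>r \<omega>. \<sigma> (X\<^sub>1 r \<omega>) - \<sigma> (X\<^sub>2 r \<omega>)"
  have prog_S: "progressive_process F ?S"
  proof -
    have "progressive_process F (\<lambda>r \<omega>. \<sigma> (X\<^sub>1 r \<omega>))" "progressive_process F (\<lambda>r \<omega>. \<sigma> (X\<^sub>2 r \<omega>))"
      using I1 I2 by (auto simp: has_ito_integral_def)
    moreover have "(\<lambda>(x, y). x - y) \<in> borel_measurable (borel :: ('em \<times> 'em) measure)"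
      unfolding borel_prod[symmetric] by measurable
    ultimately show ?thesis by (rule progressive_compose2)
  qed
  have start: "AE \<omega> in P. X\<^sub>1 0 \<omega> = X\<^sub>2 0 \<omega>"
    using X1(2) X2(2) by eventually_elim simp

  \<comment> \<open>The exceptional null set depends on \<open>N\<close> and \<open>t\<close>. Paths
    that leave the ball before \<open>t\<close> are excluded by the premise instead of being
    stopped; a larger \<open>N\<close> captures them below.\<close>
  have zero: "AE \<omega> in P. (\<forall>s\<in>{0..t}. norm (X\<^sub>1 s \<omega>) \<le> N \<and> norm (X\<^sub>2 s \<omega>) \<le> N) \<longrightarrow> j0 (X\<^sub>1 t \<omega> - X\<^sub>2 t \<omega>) = 0"
    if N: "0 < N" and t: "0 < t" for N t :: real
  proof -
    have "bounded (b ` cball 0 N)" using b_a(2) N by (auto simp: bounded_on_balls_def)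
    then obtain Cb where "\<forall>y\<in>b ` cball 0 N. norm y \<le> Cb"
      unfolding bounded_iff by blast
    then have "norm (b x) \<le> Cb" if "norm x \<le> N" for x
      using that by simp
    then have Cb: "norm (b x) \<le> \<bar>Cb\<bar>" if "norm x \<le> N" for x
      using order_trans[OF _ abs_ge_self] that by blast
    interpret sde_pair P F W j0 b ?S X\<^sub>1 X\<^sub>2 N "\<bar>Cb\<bar>" "k N" "h N" t
    proof (intro sde_pair.intro sde_pair_axioms.intro brownian_filtration_axioms)
      show "inner (b x - b y) (j0 (x - y)) \<le> k N * (norm (j0 (x - y)))\<^sup>2"
        if "norm x \<le> N" "norm y \<le> N" for x y
      proof -
        have "k (max (norm x) (norm y)) \<le> k N" using that by (intro monoD[OF b_e(1)]) auto
        from mult_right_mono[OF this zero_le_power2] show ?thesis by (rule order_trans[OF b_e(3)])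
      qed
      show "norm (\<sigma> (X\<^sub>1 s \<omega>) - \<sigma> (X\<^sub>2 s \<omega>)) \<le> h N * norm (j0 (X\<^sub>1 s \<omega> - X\<^sub>2 s \<omega>))"
        if "norm (X\<^sub>1 s \<omega>) \<le> N" "norm (X\<^sub>2 s \<omega>) \<le> N" for s \<omega>
      proof -
        have "h (max (norm (X\<^sub>1 s \<omega>)) (norm (X\<^sub>2 s \<omega>))) \<le> h N" using that by (intro monoD[OF sigma_e(1)]) auto
        from mult_right_mono[OF this norm_ge_zero] show ?thesis by (rule order_trans[OF sigma_e(3)])
      qed
    qed (use j0 b_borel Cb prog prog_S cont N t b_e(2) sigma_e(2) in auto)
    \<comment> \<open>The common initial value cancels in the difference of the two equations, and
      on paths in the ball the cutoff \<open>V\<close> is the true drift difference.\<close>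
    have "AE \<omega> in P. (\<forall>s\<in>{0..t}. norm (X\<^sub>1 s \<omega>) \<le> N \<and> norm (X\<^sub>2 s \<omega>) \<le> N) \<longrightarrow>
      (\<forall>r\<in>{0..t}. Y r \<omega> = (LINT r:{0..r}|lborel. V r \<omega>) + (I1 r \<omega> - I2 r \<omega>))"
      using eq1 eq2 int1 int2 start
    proof eventually_elim
      case (elim \<omega>)
      show ?case
      proof (intro impI ballI)
        fix r assume X: "\<forall>s\<in>{0..t}. norm (X\<^sub>1 s \<omega>) \<le> N \<and> norm (X\<^sub>2 s \<omega>) \<le> N" and r: "r \<in> {0..t}"
        have sub: "{0..r} \<subseteq> {0..t}" using r by auto
        have int: "set_integrable lborel {0..r} (\<lambda>s. b (X\<^sub>1 s \<omega>))" "set_integrable lborel {0..r} (\<lambda>s. b (X\<^sub>2 s \<omega>))"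
          using elim(3,4) t by (auto intro!: set_integrable_subset[OF _ _ sub])
        have "(LINT s:{0..r}|lborel. V s \<omega>) = (LINT s:{0..r}|lborel. b (X\<^sub>1 s \<omega>) - b (X\<^sub>2 s \<omega>))"
          using X r by (intro set_lebesgue_integral_cong) (auto simp: V_def)
        also have "\<dots> = (LINT s:{0..r}|lborel. b (X\<^sub>1 s \<omega>)) - (LINT s:{0..r}|lborel. b (X\<^sub>2 s \<omega>))"
          using int by (rule set_integral_diff)
        finally have V: "(LINT s:{0..r}|lborel. V s \<omega>)
          = (LINT s:{0..r}|lborel. b (X\<^sub>1 s \<omega>)) - (LINT s:{0..r}|lborel. b (X\<^sub>2 s \<omega>))" .
        have "j0 (X\<^sub>1 r \<omega>) = j0 (X\<^sub>1 0 \<omega>) + (LINT s:{0..r}|lborel. b (X\<^sub>1 s \<omega>)) + I1 r \<omega>"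
          "j0 (X\<^sub>2 r \<omega>) = j0 (X\<^sub>2 0 \<omega>) + (LINT s:{0..r}|lborel. b (X\<^sub>2 s \<omega>)) + I2 r \<omega>"
          using elim(1)[rule_format, of r] elim(2)[rule_format, of r] r by auto
        then have "j0 (X\<^sub>1 r \<omega>) - j0 (X\<^sub>2 r \<omega>) = (LINT s:{0..r}|lborel. V s \<omega>) + (I1 r \<omega> - I2 r \<omega>)"
          unfolding V elim(5) by simp
        then show "Y r \<omega> = (LINT s:{0..r}|lborel. V s \<omega>) + (I1 r \<omega> - I2 r \<omega>)"
          by (simp add: Y_def linear_diff[OF bounded_linear.linear[OF j0(1)]])
      qed
    qed
    from terminal_zero[OF I1 I2 refl this] show ?thesis
      by (simp add: Y_def)
  qed

  \<comment> \<open>Countably many radii and times keep the exceptional set null. The radius is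
    \<open>Suc N\<close> because \<open>zero\<close> asks for a positive one.\<close>
  have all_zero: "AE \<omega> in P. \<forall>N::nat. \<forall>q::rat. 0 < q \<longrightarrow>
      (\<forall>s\<in>{0..real_of_rat q}. norm (X\<^sub>1 s \<omega>) \<le> real (Suc N) \<and> norm (X\<^sub>2 s \<omega>) \<le> real (Suc N)) \<longrightarrow>
      j0 (X\<^sub>1 (real_of_rat q) \<omega> - X\<^sub>2 (real_of_rat q) \<omega>) = 0"
    unfolding AE_all_countable by (auto intro!: zero AE_impI simp del: of_nat_Suc)
  have equal: "AE \<omega> in P. \<forall>t\<in>{0..T}. X\<^sub>1 t \<omega> = X\<^sub>2 t \<omega>"
    using all_zero start cont[unfolded ae_continuous_paths_def]
  proof eventually_elim
    case (elim \<omega>)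
    have c: "continuous_on {0..t} (\<lambda>s. X\<^sub>1 s \<omega>)" "continuous_on {0..t} (\<lambda>s. X\<^sub>2 s \<omega>)" for t
      using elim(3,4) by (auto intro: continuous_on_subset)
    \<comment> \<open>A continuous path is bounded on \<open>{0..s}\<close>, so a radius depending
      on the path exists. Time 0 is settled by the common initial value, as \<open>zero\<close>
      covers positive times only.\<close>
    have rational: "X\<^sub>1 s \<omega> = X\<^sub>2 s \<omega>" if s: "s \<in> \<rat>" "0 \<le> s" for s
    proof (cases "s = 0")
      case False
      obtain q where q: "s = real_of_rat q" using s(1) by (rule Rats_cases)
      obtain B1 where B1: "\<forall>x\<in>(\<lambda>r. X\<^sub>1 r \<omega>) ` {0..s}. norm x \<le> B1"
        using compact_imp_bounded[OF compact_continuous_image[OF c(1)[of s] compact_Icc]]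
        unfolding bounded_iff by blast
      obtain B2 where B2: "\<forall>x\<in>(\<lambda>r. X\<^sub>2 r \<omega>) ` {0..s}. norm x \<le> B2"
        using compact_imp_bounded[OF compact_continuous_image[OF c(2)[of s] compact_Icc]]
        unfolding bounded_iff by blast
      obtain N :: nat where N: "max B1 B2 \<le> real N" using real_arch_simple by blast
      have "\<forall>r\<in>{0..s}. norm (X\<^sub>1 r \<omega>) \<le> real (Suc N) \<and> norm (X\<^sub>2 r \<omega>) \<le> real (Suc N)"
      proof
        fix r assume "r \<in> {0..s}"
        then have "norm (X\<^sub>1 r \<omega>) \<le> B1" "norm (X\<^sub>2 r \<omega>) \<le> B2" using B1 B2 by auto
        then show "norm (X\<^sub>1 r \<omega>) \<le> real (Suc N) \<and> norm (X\<^sub>2 r \<omega>) \<le> real (Suc N)"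
          using N by simp
      qed
      then have "j0 (X\<^sub>1 s \<omega> - X\<^sub>2 s \<omega>) = 0"
        using elim(1)[rule_format, of q N] False s(2) unfolding q by (simp del: of_nat_Suc)
      then have "j0 (X\<^sub>1 s \<omega>) = j0 (X\<^sub>2 s \<omega>)"
        by (simp add: linear_diff[OF bounded_linear.linear[OF j0(1)]])
      then show ?thesis using j0(2) by (rule injD[rotated])
    qed (use elim(2) in simp)
    show ?case
      using continuous_on_rationals_eq[OF c T] rational by auto
  qed
  \<comment> \<open>The event quantifies over uncountably many times; its measurability comes from
    completeness, since its complement lies in a null set. This has to be shown because
    \<open>measure\<close> is 0 on nonmeasurable sets.\<close>
  let ?A = "{\<omega> \<in> space P. \<forall>t\<in>{0..T}. X\<^sub>1 t \<omega> = X\<^sub>2 t \<omega>}"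
  obtain E where E: "{\<omega> \<in> space P. \<not> (\<forall>t\<in>{0..T}. X\<^sub>1 t \<omega> = X\<^sub>2 t \<omega>)} \<subseteq> E" "E \<in> null_sets P"
    using equal unfolding eventually_ae_filter by (elim bexE)
  have "space P - ?A = {\<omega> \<in> space P. \<not> (\<forall>t\<in>{0..T}. X\<^sub>1 t \<omega> = X\<^sub>2 t \<omega>)}" by auto
  then have "space P - ?A \<subseteq> E" using E(1) by simp
  then have "space P - ?A \<in> sets P" using E(2) by (rule complete_measure.complete[OF P(2)])
  then have "space P - (space P - ?A) \<in> sets P" by (rule sets.compl_sets)
  moreover have "space P - (space P - ?A) = ?A" by blast
  ultimately have "?A \<in> sets P" by simp
  then show ?thesis using equal by (subst prob_Collect_eq_1) auto
qed

end
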